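(* Let $(X,\Sigma,\mu)$ be a $\sigma$-finite measure space with decomposition $X=B\cup\bigcup_{i\in\mathbb{N}}A_i$ into its non-atomic part $B$ and its pairwise disjoint atoms $A_i$. Let $1\le q<\infty$, let $u_1,\dots,u_n:X\to\mathbb{C}$ be measurable functions and $\varphi_1,\dots,\varphi_n:X\to X$ non-singular measurable transformations such that $W=\sum_{r=1}^{n}u_rC_{\varphi_r}$, $Wf=\sum_{r=1}^n u_r\cdot(f\circ\varphi_r)$, is an operator from $L^\infty(\mu)$ into $L^q(\mu)$. Let $J=\sum_{r=1}^{n}h_r\,E_r(|u_r|^q)\circ\varphi_r^{-1}$. Then: (a) If (1) $W$ has closed range, (2) $W$ is injective, and (3) $\sum_{i\in\mathbb{N}}J(A_i)\mu(A_i)<\infty$, then the set $\{i\in\mathbb{N}: J(A_i)>0\}$ is finite. (b) If $J=0$ $\mu$-a.e. on $B$ and the set $\{i\in\mathbb{N}: J(A_i)>0\}$ is finite, then $W$ has closed range.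
   Context: A measurable $\varphi:X\to X$ is non-singular if $\mu\circ\varphi^{-1}$ is absolutely continuous with respect to $\mu$. For each $r$: $h_r=d(\mu\circ\varphi_r^{-1})/d\mu$, and $E_r$ is the conditional expectation with respect to $\varphi_r^{-1}(\Sigma)$, on which $\mu$ is assumed $\sigma$-finite. For non-negative measurable $f$, $E_r(f)\circ\varphi_r^{-1}$ denotes the a.e. unique $\Sigma$-measurable function $F$ that vanishes off $\{h_r\neq0\}$ and satisfies $E_r(f)=F\circ\varphi_r$ $\mu$-a.e. Every $\sigma$-finite measure space decomposes as $X=B\cup\bigcup_i A_i$, with $\{A_i\}$ a countable family of pairwise disjoint atoms of finite measure and $B$ a set, disjoint from them, containing no atoms; a measurable function $f$ is a.e. constant on each atom $A_i$, and $f(A_i)$ denotes this constant value. *)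

theory Defs
  imports "HOL-Probability.Probability"
begin

text \<open>Values outside \<open>space M\<close> are irrelevant: a class contains all the functions that agree
  almost everywhere on \<open>space M\<close>.\<close>

definition ae_class :: "'a measure \<Rightarrow> ('a \<Rightarrow> complex) \<Rightarrow> ('a \<Rightarrow> complex) set" where
  "ae_class M f = {g \<in> borel_measurable M. AE x in M. g x = f x}"

definition Lp_space :: "'a measure \<Rightarrow> real \<Rightarrow> ('a \<Rightarrow> complex) set set" where
  "Lp_space M q = ae_class M ` {f \<in> borel_measurable M. integrable M (\<lambda>x. cmod (f x) powr q)}"

definition Linf_space :: "'a measure \<Rightarrow> ('a \<Rightarrow> complex) set set" where
  "Linf_space M = ae_class M ` {f \<in> borel_measurable M. \<exists>C. AE x in M. cmod (f x) \<le> C}"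

definition Lp_dist :: "'a measure \<Rightarrow> real \<Rightarrow> ('a \<Rightarrow> complex) set \<Rightarrow> ('a \<Rightarrow> complex) set \<Rightarrow> real" where
  "Lp_dist M q F G =
     (\<integral>x. cmod ((SOME f. f \<in> F) x - (SOME g. g \<in> G) x) powr q \<partial>M) powr (1 / q)"

abbreviation Lp_topology :: "'a measure \<Rightarrow> real \<Rightarrow> ('a \<Rightarrow> complex) set topology" where
  "Lp_topology M q \<equiv> Metric_space.mtopology (Lp_space M q) (Lp_dist M q)"

lemma ae_class_self: "f \<in> borel_measurable M \<Longrightarrow> f \<in> ae_class M f"
  by (simp add: ae_class_def)

lemma ae_class_eq_iff:
  assumes "f \<in> borel_measurable M" "g \<in> borel_measurable M"
  shows "ae_class M f = ae_class M g \<longleftrightarrow> (AE x in M. f x = g x)"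
proof
  assume "ae_class M f = ae_class M g"
  then have "f \<in> ae_class M g" using ae_class_self assms by metis
  then show "AE x in M. f x = g x" by (simp add: ae_class_def)
next
  assume *: "AE x in M. f x = g x"
  show "ae_class M f = ae_class M g"
  proof (intro set_eqI)
    fix h
    have "(AE x in M. h x = f x) \<longleftrightarrow> (AE x in M. h x = g x)"
    proof
      assume "AE x in M. h x = f x"
      with * show "AE x in M. h x = g x" by eventually_elim simp
    next
      assume "AE x in M. h x = g x"
      with * show "AE x in M. h x = f x" by eventually_elim simp
    qed
    then show "h \<in> ae_class M f \<longleftrightarrow> h \<in> ae_class M g"
      by (simp add: ae_class_def)
  qed
qed

lemma some_ae_class:
  assumes "f \<in> borel_measurable M"
  shows "(SOME g. g \<in> ae_class M f) \<in> borel_measurable M"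
    and "AE x in M. (SOME g. g \<in> ae_class M f) x = f x"
proof -
  have "(SOME g. g \<in> ae_class M f) \<in> ae_class M f"
    using someI[of "\<lambda>g. g \<in> ae_class M f" f] ae_class_self[OF assms] by blast
  then show "(SOME g. g \<in> ae_class M f) \<in> borel_measurable M"
    and "AE x in M. (SOME g. g \<in> ae_class M f) x = f x"
    unfolding ae_class_def mem_Collect_eq by blast+
qed

lemma Lp_dist_ae_class:
  assumes [measurable]: "f \<in> borel_measurable M" "g \<in> borel_measurable M"
  shows "Lp_dist M q (ae_class M f) (ae_class M g) =
           (\<integral>x. cmod (f x - g x) powr q \<partial>M) powr (1 / q)"
proof -
  note [measurable] = some_ae_class(1)[OF assms(1)] some_ae_class(1)[OF assms(2)]
  have "AE x in M. cmod ((SOME h. h \<in> ae_class M f) x - (SOME h. h \<in> ae_class M g) x) powr q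
      = cmod (f x - g x) powr q"
    using some_ae_class(2)[OF assms(1)] some_ae_class(2)[OF assms(2)]
    by eventually_elim simp
  then have "(\<integral>x. cmod ((SOME h. h \<in> ae_class M f) x - (SOME h. h \<in> ae_class M g) x) powr q \<partial>M)
      = (\<integral>x. cmod (f x - g x) powr q \<partial>M)"
    by (intro integral_cong_AE) measurable
  then show ?thesis by (simp add: Lp_dist_def)
qed

lemma powr_mean_le:
  fixes x y l :: real
  assumes q: "1 \<le> q" and "0 \<le> x" "0 \<le> y" "0 \<le> l" "l \<le> 1"
  shows "(l * x + (1 - l) * y) powr q \<le> l * x powr q + (1 - l) * y powr q"
proof -
  have c: "convex_on {0<..} (\<lambda>x::real. x powr q)"
    using q by (rule powr_convex)
  consider "x = 0" | "y = 0" | "0 < x" "0 < y" using assms by linarith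
  then show ?thesis
  proof cases
    case 1
    have "(1 - l) powr q \<le> (1 - l) powr 1" using assms by (intro powr_mono') auto
    then have "(1 - l) powr q * y powr q \<le> (1 - l) * y powr q"
      using assms by (intro mult_right_mono) auto
    then show ?thesis using 1 assms by (simp add: powr_mult)
  next
    case 2
    have "l powr q \<le> l powr 1" using assms by (intro powr_mono') auto
    then have "l powr q * x powr q \<le> l * x powr q"
      using assms by (intro mult_right_mono) auto
    then show ?thesis using 2 assms by (simp add: powr_mult)
  next
    case 3
    then show ?thesis
      using convex_onD[OF c, of "1 - l" x y] assms by simp
  qed
qed

lemma Minkowski_powr:
  fixes f g :: "'a \<Rightarrow> complex"
  assumes q: "1 \<le> q"
    and [measurable]: "f \<in> borel_measurable M" "g \<in> borel_measurable M"
    and f: "integrable M (\<lambda>x. cmod (f x) powr q)"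
    and g: "integrable M (\<lambda>x. cmod (g x) powr q)"
  shows "integrable M (\<lambda>x. cmod (f x + g x) powr q)"
    and "(\<integral>x. cmod (f x + g x) powr q \<partial>M) powr (1 / q) \<le>
           (\<integral>x. cmod (f x) powr q \<partial>M) powr (1 / q) + (\<integral>x. cmod (g x) powr q \<partial>M) powr (1 / q)"
proof -
  define N where "N = (\<lambda>f :: 'a \<Rightarrow> complex. (\<integral>x. cmod (f x) powr q \<partial>M) powr (1 / q))"
  have bound: "cmod (f x + g x) powr q \<le>
      (a + b) powr q * (a / (a + b) * (cmod (f x) / a) powr q + (1 - a / (a + b)) * (cmod (g x) / b) powr q)"
    if ab: "0 < a" "0 < b" for a b x
  proof -
    have "cmod (f x + g x) powr q \<le> (cmod (f x) + cmod (g x)) powr q"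
      using q by (intro powr_mono2) (auto simp: norm_triangle_ineq)
    also have "cmod (f x) + cmod (g x) =
        (a + b) * (a / (a + b) * (cmod (f x) / a) + (1 - a / (a + b)) * (cmod (g x) / b))"
    proof -
      have "a + b \<noteq> 0" using ab by linarith
      then have e: "1 - a / (a + b) = b / (a + b)" by (simp add: field_simps)
      have "(a + b) * (a / (a + b) * X + b / (a + b) * Y) = a * X + b * Y" for X Y
        using \<open>a + b \<noteq> 0\<close> by (simp add: distrib_left)
      from this[of "cmod (f x) / a" "cmod (g x) / b"] show ?thesis
        unfolding e using ab by simp
    qed
    also have "\<dots> powr q = (a + b) powr q *
        (a / (a + b) * (cmod (f x) / a) + (1 - a / (a + b)) * (cmod (g x) / b)) powr q"
      using ab by (intro powr_mult)
    also have "\<dots> \<le> (a + b) powr q *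
        (a / (a + b) * (cmod (f x) / a) powr q + (1 - a / (a + b)) * (cmod (g x) / b) powr q)"
      using ab q by (intro mult_left_mono powr_mean_le) auto
    finally show ?thesis .
  qed
  have fi: "integrable M (\<lambda>x. (cmod (f x) / a) powr q)" if "0 < a" for a
    using f that by (simp add: powr_divide)
  have gi: "integrable M (\<lambda>x. (cmod (g x) / a) powr q)" if "0 < a" for a
    using g that by (simp add: powr_divide)
  show int: "integrable M (\<lambda>x. cmod (f x + g x) powr q)"
    by (rule Bochner_Integration.integrable_bound[OF _ _ AE_I2, where
          f = "\<lambda>x. (1 + 1) powr q * (1 / (1 + 1) * (cmod (f x) / 1) powr q + (1 - 1 / (1 + 1)) * (cmod (g x) / 1) powr q)"])
       (use f g bound[of 1 1] in \<open>auto intro: order_trans[OF _ abs_ge_self]\<close>)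
  have zero: "AE x in M. h x = 0"
    if "h \<in> borel_measurable M" "integrable M (\<lambda>x. cmod (h x) powr q)" "N h = 0"
    for h :: "'a \<Rightarrow> complex"
  proof -
    have "(\<integral>x. cmod (h x) powr q \<partial>M) = 0" using that(3) by (simp add: N_def)
    then have "AE x in M. cmod (h x) powr q = 0"
      using integral_nonneg_eq_0_iff_AE[OF that(2)] by simp
    then show ?thesis by simp
  qed
  have Npow: "N h powr q = (\<integral>x. cmod (h x) powr q \<partial>M)" for h
    using q by (simp add: N_def powr_powr)
  have N0: "0 \<le> N h" for h by (simp add: N_def)
  have "N (\<lambda>x. f x + g x) \<le> N f + N g"
  proof (cases "N f = 0 \<or> N g = 0")
    case True
    then show ?thesis
    proof
      assume "N f = 0"
      then have "AE x in M. f x = 0" using zero f by simp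
      then have "AE x in M. cmod (f x + g x) powr q = cmod (g x) powr q"
        by eventually_elim simp
      then have "(\<integral>x. cmod (f x + g x) powr q \<partial>M) = (\<integral>x. cmod (g x) powr q \<partial>M)"
        by (intro integral_cong_AE) measurable
      then show ?thesis using N0 by (simp add: N_def)
    next
      assume "N g = 0"
      then have "AE x in M. g x = 0" using zero g by simp
      then have "AE x in M. cmod (f x + g x) powr q = cmod (f x) powr q"
        by eventually_elim simp
      then have "(\<integral>x. cmod (f x + g x) powr q \<partial>M) = (\<integral>x. cmod (f x) powr q \<partial>M)"
        by (intro integral_cong_AE) measurable
      then show ?thesis using N0 by (simp add: N_def)
    qed
  next
    case False
    define a b where "a = N f" and "b = N g"
    have ab: "0 < a" "0 < b" using False N0[of f] N0[of g] by (auto simp: a_def b_def)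
    have fa: "(\<integral>x. (cmod (f x) / a) powr q \<partial>M) = 1"
    proof -
      have "(\<integral>x. cmod (f x) powr q \<partial>M) = a powr q" using Npow[of f] by (simp add: a_def)
      then show ?thesis using ab by (simp add: powr_divide)
    qed
    have gb: "(\<integral>x. (cmod (g x) / b) powr q \<partial>M) = 1"
    proof -
      have "(\<integral>x. cmod (g x) powr q \<partial>M) = b powr q" using Npow[of g] by (simp add: b_def)
      then show ?thesis using ab by (simp add: powr_divide)
    qed
    have "(\<integral>x. cmod (f x + g x) powr q \<partial>M) \<le>
        (\<integral>x. (a + b) powr q * (a / (a + b) * (cmod (f x) / a) powr q + (1 - a / (a + b)) * (cmod (g x) / b) powr q) \<partial>M)"
      using int fi gi ab by (intro integral_mono bound) auto
    also have "\<dots> = (a + b) powr q"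
      using fi gi ab by (simp add: fa gb)
    finally have "N (\<lambda>x. f x + g x) \<le> ((a + b) powr q) powr (1 / q)"
      unfolding N_def using q by (intro powr_mono2) auto
    also have "\<dots> = a + b" using ab q by (simp add: powr_powr)
    finally show ?thesis by (simp add: a_def b_def)
  qed
  then show "(\<integral>x. cmod (f x + g x) powr q \<partial>M) powr (1 / q) \<le>
      (\<integral>x. cmod (f x) powr q \<partial>M) powr (1 / q) + (\<integral>x. cmod (g x) powr q \<partial>M) powr (1 / q)"
    by (simp add: N_def)
qed

lemma Metric_space_Lp:
  assumes q: "1 \<le> q"
  shows "Metric_space (Lp_space M q) (Lp_dist M q)"
proof
  fix F G H
  show "0 \<le> Lp_dist M q F G" by (simp add: Lp_dist_def)
  show "Lp_dist M q F G = Lp_dist M q G F" by (simp add: Lp_dist_def norm_minus_commute)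
  assume "F \<in> Lp_space M q" and "G \<in> Lp_space M q"
  then obtain f g where
    f[measurable]: "f \<in> borel_measurable M" "integrable M (\<lambda>x. cmod (f x) powr q)" "F = ae_class M f" and
    g[measurable]: "g \<in> borel_measurable M" "integrable M (\<lambda>x. cmod (g x) powr q)" "G = ae_class M g"
    by (auto simp: Lp_space_def)
  have diff: "integrable M (\<lambda>x. cmod (h x - k x) powr q)"
    if "h \<in> borel_measurable M" "integrable M (\<lambda>x. cmod (h x) powr q)"
       "k \<in> borel_measurable M" "integrable M (\<lambda>x. cmod (k x) powr q)" for h k :: "'a \<Rightarrow> complex"
    using Minkowski_powr(1)[OF q that(1) _ that(2), of "\<lambda>x. - k x"] that by simp
  have "Lp_dist M q F G = 0 \<longleftrightarrow> (AE x in M. cmod (f x - g x) powr q = 0)"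
    using integral_nonneg_eq_0_iff_AE[OF diff[OF f(1,2) g(1,2)]]
    by (simp add: f(3) g(3) Lp_dist_ae_class[OF f(1) g(1)])
  also have "\<dots> \<longleftrightarrow> F = G" by (simp add: f(3) g(3) ae_class_eq_iff[OF f(1) g(1)])
  finally show "Lp_dist M q F G = 0 \<longleftrightarrow> F = G" .
  assume "H \<in> Lp_space M q"
  then obtain h where
    h[measurable]: "h \<in> borel_measurable M" "integrable M (\<lambda>x. cmod (h x) powr q)" "H = ae_class M h"
    by (auto simp: Lp_space_def)
  show "Lp_dist M q F H \<le> Lp_dist M q F G + Lp_dist M q G H"
    using Minkowski_powr(2)[OF q _ _ diff[OF f(1,2) g(1,2)] diff[OF g(1,2) h(1,2)]]
    by (simp add: f(3) g(3) h(3) Lp_dist_ae_class)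
qed

definition nonsingular_map :: "'a measure \<Rightarrow> ('a \<Rightarrow> 'a) \<Rightarrow> bool" where
  "nonsingular_map M \<phi> \<longleftrightarrow> \<phi> \<in> measurable M M \<and> absolutely_continuous M (distr M M \<phi>)"

definition wco_fun ::
  "nat \<Rightarrow> (nat \<Rightarrow> 'a \<Rightarrow> complex) \<Rightarrow> (nat \<Rightarrow> 'a \<Rightarrow> 'a) \<Rightarrow> ('a \<Rightarrow> complex) \<Rightarrow> 'a \<Rightarrow> complex" where
  "wco_fun n u \<phi> f = (\<lambda>x. \<Sum>r=1..n. u r x * f (\<phi> r x))"

text \<open>The operator on classes: for non-singular maps the classes in the union coincide, by
  \<open>wco_ae_class\<close>.\<close>

definition wco ::
  "'a measure \<Rightarrow> nat \<Rightarrow> (nat \<Rightarrow> 'a \<Rightarrow> complex) \<Rightarrow> (nat \<Rightarrow> 'a \<Rightarrow> 'a) \<Rightarrow>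
     ('a \<Rightarrow> complex) set \<Rightarrow> ('a \<Rightarrow> complex) set" where
  "wco M n u \<phi> F = (\<Union>f\<in>F. ae_class M (wco_fun n u \<phi> f))"

lemma nonsingular_AE:
  assumes "nonsingular_map M \<phi>" and "AE x in M. P x"
  shows "AE x in M. P (\<phi> x)"
proof -
  have m: "\<phi> \<in> measurable M M" and ac: "absolutely_continuous M (distr M M \<phi>)"
    using assms(1) by (auto simp: nonsingular_map_def)
  obtain N where N: "N \<in> null_sets M" "{x \<in> space M. \<not> P x} \<subseteq> N"
    using assms(2) by (auto simp: eventually_ae_filter)
  have "N \<in> null_sets (distr M M \<phi>)" using ac N(1) by (auto simp: absolutely_continuous_def)
  then have "\<phi> -` N \<inter> space M \<in> null_sets M"
    using m null_setsD1[of N] by (auto simp: null_sets_def emeasure_distr)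
  then show ?thesis
  proof (rule AE_I')
    show "{x \<in> space M. \<not> P (\<phi> x)} \<subseteq> \<phi> -` N \<inter> space M"
    proof
      fix x assume "x \<in> {x \<in> space M. \<not> P (\<phi> x)}"
      then have x: "x \<in> space M" "\<not> P (\<phi> x)" by simp_all
      then have "\<phi> x \<in> N" using N(2) measurable_space[OF m x(1)] by blast
      with x(1) show "x \<in> \<phi> -` N \<inter> space M" by simp
    qed
  qed
qed

lemma wco_ae_class:
  assumes "\<And>r. r \<in> {1..n} \<Longrightarrow> u r \<in> borel_measurable M"
    and ns: "\<And>r. r \<in> {1..n} \<Longrightarrow> nonsingular_map M (\<phi> r)"
    and f: "f \<in> borel_measurable M"
  shows "wco M n u \<phi> (ae_class M f) = ae_class M (wco_fun n u \<phi> f)"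
proof -
  have meas: "wco_fun n u \<phi> g \<in> borel_measurable M" if [measurable]: "g \<in> borel_measurable M" for g
    unfolding wco_fun_def
  proof (intro borel_measurable_sum borel_measurable_times)
    fix r assume r: "r \<in> {1..n}"
    show "u r \<in> borel_measurable M" using assms(1) r .
    have [measurable]: "\<phi> r \<in> measurable M M" using ns[OF r] by (simp add: nonsingular_map_def)
    show "(\<lambda>x. g (\<phi> r x)) \<in> borel_measurable M" by measurable
  qed
  have "ae_class M (wco_fun n u \<phi> g) = ae_class M (wco_fun n u \<phi> f)" if "g \<in> ae_class M f" for g
  proof -
    have g: "g \<in> borel_measurable M" "AE x in M. g x = f x" using that by (auto simp: ae_class_def)
    have "AE x in M. \<forall>r\<in>{1..n}. g (\<phi> r x) = f (\<phi> r x)"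
      by (intro AE_finite_allI nonsingular_AE[OF ns g(2)]) auto
    then have "AE x in M. wco_fun n u \<phi> g x = wco_fun n u \<phi> f x"
      by (rule AE_mp) (simp add: wco_fun_def)
    then show ?thesis using ae_class_eq_iff meas f g(1) by blast
  qed
  then have "wco M n u \<phi> (ae_class M f) = (\<Union>g\<in>ae_class M f. ae_class M (wco_fun n u \<phi> f))"
    unfolding wco_def by (rule SUP_cong[OF refl])
  also have "\<dots> = ae_class M (wco_fun n u \<phi> f)"
    using ae_class_self[OF f] by (intro UN_constant_eq) auto
  finally show ?thesis .
qed

definition h_deriv :: "'a measure \<Rightarrow> ('a \<Rightarrow> 'a) \<Rightarrow> 'a \<Rightarrow> ennreal" where
  "h_deriv M \<phi> = RN_deriv M (distr M M \<phi>)"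

definition preimage_algebra :: "'a measure \<Rightarrow> ('a \<Rightarrow> 'a) \<Rightarrow> 'a measure" where
  "preimage_algebra M \<phi> = vimage_algebra (space M) \<phi> M"

text \<open>\<open>cond_exp_pull M \<phi> f\<close> is \<open>E(f) \<circ> \<phi>\<^sup>-\<^sup>1\<close>, where \<open>E\<close> is the conditional expectation with respect
  to the sigma-algebra of preimages under \<open>\<phi>\<close>. Existence and almost everywhere uniqueness are proved
  below. It may take the value \<open>\<infinity>\<close>, so \<open>wco_J\<close> relies on \<open>0 * \<infinity> = 0\<close>.\<close>

definition is_cond_exp_pull ::
  "'a measure \<Rightarrow> ('a \<Rightarrow> 'a) \<Rightarrow> ('a \<Rightarrow> ennreal) \<Rightarrow> ('a \<Rightarrow> ennreal) \<Rightarrow> bool" where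
  "is_cond_exp_pull M \<phi> f F \<longleftrightarrow>
     F \<in> borel_measurable M \<and>
     (\<forall>x\<in>space M. h_deriv M \<phi> x = 0 \<longrightarrow> F x = 0) \<and>
     (AE x in M. nn_cond_exp M (preimage_algebra M \<phi>) f x = F (\<phi> x))"

definition cond_exp_pull ::
  "'a measure \<Rightarrow> ('a \<Rightarrow> 'a) \<Rightarrow> ('a \<Rightarrow> ennreal) \<Rightarrow> 'a \<Rightarrow> ennreal" where
  "cond_exp_pull M \<phi> f = (SOME F. is_cond_exp_pull M \<phi> f F)"

definition wco_J ::
  "'a measure \<Rightarrow> real \<Rightarrow> nat \<Rightarrow> (nat \<Rightarrow> 'a \<Rightarrow> complex) \<Rightarrow> (nat \<Rightarrow> 'a \<Rightarrow> 'a) \<Rightarrow> 'a \<Rightarrow> ennreal" where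
  "wco_J M q n u \<phi> = (\<lambda>x. \<Sum>r=1..n.
     h_deriv M (\<phi> r) x * cond_exp_pull M (\<phi> r) (\<lambda>y. ennreal (cmod (u r y) powr q)) x)"

lemma factor_through_map:
  fixes f :: "'a \<Rightarrow> ennreal"
  assumes \<phi>: "\<phi> \<in> measurable M M" and "f \<in> borel_measurable (preimage_algebra M \<phi>)"
  shows "\<exists>G \<in> borel_measurable M. \<forall>x\<in>space M. f x = G (\<phi> x)"
  using assms(2)
proof (induction rule: borel_measurable_induct)
  case (cong f g)
  then show ?case by (auto simp: preimage_algebra_def)
next
  case (set A)
  then obtain B where "B \<in> sets M" "A = \<phi> -` B \<inter> space M"
    using measurable_space[OF \<phi>] by (auto simp: preimage_algebra_def sets_vimage_algebra2)
  then show ?case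
    by (intro bexI[of _ "indicator B"]) (auto simp: indicator_def)
next
  case (mult u c)
  then obtain G where "G \<in> borel_measurable M" "\<forall>x\<in>space M. u x = G (\<phi> x)" by blast
  then show ?case by (intro bexI[of _ "\<lambda>x. c * G x"]) auto
next
  case (add u v)
  then obtain G H where "G \<in> borel_measurable M" "\<forall>x\<in>space M. u x = G (\<phi> x)"
    "H \<in> borel_measurable M" "\<forall>x\<in>space M. v x = H (\<phi> x)" by blast
  then show ?case by (intro bexI[of _ "\<lambda>x. H x + G x"]) auto
next
  case (seq U)
  then obtain G where "\<And>i. G i \<in> borel_measurable M" "\<And>i. \<forall>x\<in>space M. U i x = G i (\<phi> x)"
    by metis
  then show ?case
    by (intro bexI[of _ "\<lambda>x. SUP i. G i x"]) (auto simp: SUP_apply image_comp)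
qed

lemma (in sigma_finite_measure) nonsingular_null_iff:
  assumes ns: "nonsingular_map M \<phi>" and S: "S \<in> sets M"
  shows "\<phi> -` S \<inter> space M \<in> null_sets M \<longleftrightarrow> (AE x in M. x \<in> S \<longrightarrow> h_deriv M \<phi> x = 0)"
proof -
  have m: "\<phi> \<in> measurable M M" and ac: "absolutely_continuous M (distr M M \<phi>)"
    using ns by (auto simp: nonsingular_map_def)
  have "emeasure M (\<phi> -` S \<inter> space M) = emeasure (density M (h_deriv M \<phi>)) S"
    using density_RN_deriv[OF ac] m S by (simp add: h_deriv_def emeasure_distr)
  also have "\<dots> = (\<integral>\<^sup>+x. h_deriv M \<phi> x * indicator S x \<partial>M)"
    using S by (simp add: emeasure_density h_deriv_def)
  also have "\<dots> = 0 \<longleftrightarrow> (AE x in M. h_deriv M \<phi> x * indicator S x = 0)"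
    using S by (intro nn_integral_0_iff_AE) (simp add: h_deriv_def)
  also have "\<dots> \<longleftrightarrow> (AE x in M. x \<in> S \<longrightarrow> h_deriv M \<phi> x = 0)"
    by (intro AE_cong) (auto simp: indicator_def)
  finally show ?thesis using m S by (auto simp: null_sets_def)
qed

lemma (in sigma_finite_measure) is_cond_exp_pull_exists:
  assumes ns: "nonsingular_map M \<phi>"
  shows "\<exists>F. is_cond_exp_pull M \<phi> f F"
proof -
  have m: "\<phi> \<in> measurable M M" using ns by (auto simp: nonsingular_map_def)
  have [measurable]: "h_deriv M \<phi> \<in> borel_measurable M" by (simp add: h_deriv_def)
  obtain G where G[measurable]: "G \<in> borel_measurable M"
    and eq: "\<forall>x\<in>space M. nn_cond_exp M (preimage_algebra M \<phi>) f x = G (\<phi> x)"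
    using factor_through_map[OF m borel_measurable_nn_cond_exp] by blast
  define S where "S = {x \<in> space M. h_deriv M \<phi> x = 0}"
  have S: "S \<in> sets M" by (simp add: S_def)
  define F where "F = (\<lambda>x. if h_deriv M \<phi> x = 0 then 0 else G x)"
  have "\<phi> -` S \<inter> space M \<in> null_sets M"
    using nonsingular_null_iff[OF ns S] by (simp add: S_def)
  then have "AE x in M. nn_cond_exp M (preimage_algebra M \<phi>) f x = F (\<phi> x)"
    by (rule AE_I') (use eq measurable_space[OF m] in \<open>auto simp: F_def S_def\<close>)
  moreover have "F \<in> borel_measurable M" unfolding F_def by measurable
  ultimately show ?thesis
    unfolding is_cond_exp_pull_def by (intro exI[of _ F]) (auto simp: F_def)
qed

lemma (in sigma_finite_measure) cond_exp_pull:
  "nonsingular_map M \<phi> \<Longrightarrow> is_cond_exp_pull M \<phi> f (cond_exp_pull M \<phi> f)"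
  unfolding cond_exp_pull_def using is_cond_exp_pull_exists by (rule someI_ex)

lemma (in sigma_finite_measure) is_cond_exp_pull_unique:
  assumes ns: "nonsingular_map M \<phi>"
    and F: "is_cond_exp_pull M \<phi> f F" and G: "is_cond_exp_pull M \<phi> f G"
  shows "AE x in M. F x = G x"
proof -
  have m[measurable]: "\<phi> \<in> measurable M M" using ns by (auto simp: nonsingular_map_def)
  have [measurable]: "F \<in> borel_measurable M" "G \<in> borel_measurable M"
    using F G by (auto simp: is_cond_exp_pull_def)
  define S where "S = {x \<in> space M. F x \<noteq> G x}"
  have S: "S \<in> sets M" by (simp add: S_def)
  have "AE x in M. nn_cond_exp M (preimage_algebra M \<phi>) f x = F (\<phi> x)"
       "AE x in M. nn_cond_exp M (preimage_algebra M \<phi>) f x = G (\<phi> x)"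
    using F G by (auto simp: is_cond_exp_pull_def)
  then have "AE x in M. \<phi> x \<notin> S"
    by eventually_elim (auto simp: S_def)
  then have "\<phi> -` S \<inter> space M \<in> null_sets M"
    using S by (subst AE_iff_null_sets) auto
  then have h0: "AE x in M. x \<in> S \<longrightarrow> h_deriv M \<phi> x = 0"
    using nonsingular_null_iff[OF ns S] by blast
  note FG = F[unfolded is_cond_exp_pull_def, THEN conjunct2, THEN conjunct1]
    G[unfolded is_cond_exp_pull_def, THEN conjunct2, THEN conjunct1]
  show ?thesis
  proof (rule AE_mp[OF h0], intro AE_I2 impI)
    fix x assume x: "x \<in> space M" "x \<in> S \<longrightarrow> h_deriv M \<phi> x = 0"
    show "F x = G x"
    proof (rule ccontr)
      assume ne: "F x \<noteq> G x"
      then have "h_deriv M \<phi> x = 0" using x by (simp add: S_def)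
      then have "F x = 0" "G x = 0"
        using FG(1)[rule_format, OF x(1)] FG(2)[rule_format, OF x(1)] by blast+
      with ne show False by simp
    qed
  qed
qed

definition is_atom :: "'a measure \<Rightarrow> 'a set \<Rightarrow> bool" where
  "is_atom M A \<longleftrightarrow> A \<in> sets M \<and> 0 < emeasure M A \<and>
     (\<forall>C\<in>sets M. C \<subseteq> A \<longrightarrow> emeasure M C = 0 \<or> emeasure M C = emeasure M A)"

text \<open>The index set \<open>I\<close> allows finitely many atoms as well as infinitely many.\<close>

definition atomic_decomposition ::
  "'a measure \<Rightarrow> 'a set \<Rightarrow> nat set \<Rightarrow> (nat \<Rightarrow> 'a set) \<Rightarrow> bool" where
  "atomic_decomposition M B I A \<longleftrightarrow>
     (\<forall>i\<in>I. is_atom M (A i) \<and> emeasure M (A i) < \<infinity>) \<and>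
     disjoint_family_on A I \<and>
     B \<in> sets M \<and> (\<forall>i\<in>I. B \<inter> A i = {}) \<and>
     \<not> (\<exists>C. C \<subseteq> B \<and> is_atom M C) \<and>
     space M = B \<union> (\<Union>i\<in>I. A i)"

text \<open>The constant is well defined by \<open>ae_const_on_atom\<close>.\<close>

definition atom_value :: "'a measure \<Rightarrow> ('a \<Rightarrow> ennreal) \<Rightarrow> 'a set \<Rightarrow> ennreal" where
  "atom_value M f A = (THE c. AE x in M. x \<in> A \<longrightarrow> f x = c)"

lemma ae_const_on_atom:
  fixes f :: "'a \<Rightarrow> ennreal"
  assumes A: "is_atom M A" "emeasure M A < \<infinity>" and f[measurable]: "f \<in> borel_measurable M"
  shows "\<exists>!c. AE x in M. x \<in> A \<longrightarrow> f x = c"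
proof -
  have A_sets[measurable]: "A \<in> sets M" and pos: "0 < emeasure M A" using A by (auto simp: is_atom_def)
  have dich: "(AE x in M. x \<in> A \<longrightarrow> t \<le> f x) \<or> (AE x in M. x \<in> A \<longrightarrow> f x < t)" for t
  proof -
    define C where "C = {x \<in> space M. x \<in> A \<and> f x < t}"
    have C: "C \<in> sets M" "C \<subseteq> A" by (auto simp: C_def)
    have AC: "A - C \<in> sets M" using C by simp
    consider "emeasure M C = 0" | "emeasure M C = emeasure M A"
      using A(1) C by (auto simp: is_atom_def)
    then show ?thesis
    proof cases
      case 1
      then have "C \<in> null_sets M" using C by auto
      then have "AE x in M. x \<in> A \<longrightarrow> t \<le> f x" by (rule AE_I') (auto simp: C_def)
      then show ?thesis ..
    next
      case 2
      then have "emeasure M (A - C) = 0"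
        using emeasure_Diff[of M C A] C A(2) by auto
      then have "A - C \<in> null_sets M" using AC by auto
      then have "AE x in M. x \<in> A \<longrightarrow> f x < t"
        by (rule AE_I') (auto simp: C_def)
      then show ?thesis ..
    qed
  qed
  define S where "S = {t. AE x in M. x \<in> A \<longrightarrow> t \<le> f x}"
  define c where "c = Sup S"
  have "0 \<in> S" by (simp add: S_def)
  then have "S \<noteq> {}" by blast
  then obtain s :: "nat \<Rightarrow> ennreal" where s: "range s \<subseteq> S" "c = (SUP n. s n)"
    using ennreal_Sup_countable_SUP[of S] unfolding c_def by metis
  have "AE x in M. \<forall>n. x \<in> A \<longrightarrow> s n \<le> f x"
    unfolding AE_all_countable using s(1) by (auto simp: S_def)
  then have ge: "AE x in M. x \<in> A \<longrightarrow> c \<le> f x"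
    by eventually_elim (auto simp: s(2) intro!: SUP_least)
  have le: "AE x in M. x \<in> A \<longrightarrow> f x \<le> c"
  proof (cases "c = \<infinity>")
    case False
    then have "c < top" by (simp add: less_top)
    then obtain t :: "nat \<Rightarrow> ennreal" where t: "\<And>n. c < t n" "t \<longlonglongrightarrow> c"
      using approx_from_above_dense_linorder[of c top] by auto
    have "AE x in M. x \<in> A \<longrightarrow> f x < t n" for n
    proof -
      have "t n \<notin> S" using t(1)[of n] Sup_upper[of "t n" S] unfolding c_def by (meson not_le)
      then show ?thesis using dich[of "t n"] unfolding S_def mem_Collect_eq by blast
    qed
    then have "AE x in M. \<forall>n. x \<in> A \<longrightarrow> f x < t n"
      unfolding AE_all_countable by blast
    then show ?thesis
    proof eventually_elim
      case (elim x)
      show ?case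
      proof
        assume "x \<in> A"
        then show "f x \<le> c" using elim by (intro LIMSEQ_le_const[OF t(2)]) (auto intro: less_imp_le)
      qed
    qed
  qed simp
  show ?thesis
  proof (intro ex1I)
    show "AE x in M. x \<in> A \<longrightarrow> f x = c" using ge le by eventually_elim auto
  next
    fix d assume "AE x in M. x \<in> A \<longrightarrow> f x = d"
    moreover have "AE x in M. x \<in> A \<longrightarrow> f x = c" using ge le by eventually_elim auto
    ultimately have "AE x in M. x \<in> A \<longrightarrow> c = d" by eventually_elim auto
    show "d = c"
    proof (rule ccontr)
      assume "d \<noteq> c"
      with \<open>AE x in M. x \<in> A \<longrightarrow> c = d\<close> have "AE x in M. x \<notin> A" by auto
      then have "A \<in> null_sets M" using A_sets by (simp add: AE_iff_null_sets)
      then show False using pos by auto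
    qed
  qed
qed

end

theory Submission
  imports Defs
begin

text \<open>Change of variables gives \<open>\<integral> J g = \<Sum>\<^sub>r \<integral> |u\<^sub>r|\<^sup>q (g \<circ> \<phi>\<^sub>r)\<close>, hence \<open>\<parallel>W g\<parallel>\<^sub>q\<^sup>q \<le> n\<^sup>q \<integral> J |g|\<^sup>q\<close>.

  (a) If there were infinitely many atoms, summability would yield a subsequence \<open>D\<^sub>k\<close> of them with
  \<open>\<Sum>\<^sub>k (k+1)\<^sup>q \<integral>\<^bsub>D\<^sub>k\<^esub> J < \<infinity>\<close>. For bounded \<open>d\<close>, the function \<open>g\<^sub>d = \<Sum>\<^sub>k (k+1) d\<^sub>k 1\<^bsub>D\<^sub>k\<^esub>\<close> is then an
  \<open>L\<^sup>q(J)\<close>-limit of bounded functions, so closedness of the range provides a bounded \<open>f\<close> with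
  \<open>W f = W g\<^sub>d\<close>. A Baire category argument over \<open>d \<in> \<ell>\<^sup>\<infinity>\<close> bounds \<open>\<parallel>f\<parallel>\<^sub>\<infinity>\<close> uniformly for \<open>\<parallel>d\<parallel> \<le> 1\<close>; for
  the unit vectors \<open>d = e\<^sub>k\<close> injectivity forces \<open>f = (k+1) 1\<^bsub>D\<^sub>k\<^esub>\<close>, a contradiction. Continuity of \<open>W\<close> and
  completeness of \<open>L\<^sup>q\<close> are not needed, because \<open>W\<close> is defined pointwise.

  (b) \<open>W f\<close> depends only on the values of \<open>f\<close> on the finitely many atoms where \<open>J > 0\<close>, so the range
  is finite-dimensional. Its closedness is reduced to pointwise limits along an almost everywhere
  convergent subsequence.\<close>

section \<open>Baire category and spans of finitely many functions\<close>

text \<open>Zabreiko's lemma: read \<open>Q x C\<close> as \<open>p x \<le> C\<close> for a countably subadditive seminorm \<open>p\<close>. Using a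
  relation avoids taking the infimum of the admissible bounds.\<close>

lemma countably_subadditive_bounded:
  fixes Q :: "'a::{real_normed_vector, complete_space} \<Rightarrow> real \<Rightarrow> bool"
  assumes ex: "\<And>x. \<exists>C. Q x C"
    and mono: "\<And>x C D. Q x C \<Longrightarrow> C \<le> D \<Longrightarrow> Q x D"
    and scale: "\<And>x C t. Q x C \<Longrightarrow> Q (t *\<^sub>R x) (\<bar>t\<bar> * C)"
    and sums: "\<And>s x c. (\<And>n. Q (s n) (c n)) \<Longrightarrow> s sums x \<Longrightarrow> summable c \<Longrightarrow> Q x (\<Sum>n. c n)"
  shows "\<exists>C. \<forall>x. norm x \<le> 1 \<longrightarrow> Q x C"
proof -
  have zero: "Q 0 0" using scale[of _ _ 0] ex by (metis abs_zero mult_zero_left scaleR_zero_left)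
  have add: "Q (x + y) (C + D)" if "Q x C" "Q y D" for x y C D
  proof -
    define s where "s = (\<lambda>n::nat. if n = 0 then x else if n = 1 then y else 0)"
    define c where "c = (\<lambda>n::nat. if n = 0 then C else if n = 1 then D else 0)"
    have "s sums (\<Sum>n\<in>{0,1}. s n)" by (rule sums_finite) (auto simp: s_def)
    moreover have c: "c sums (\<Sum>n\<in>{0,1}. c n)" by (rule sums_finite) (auto simp: c_def)
    moreover have "Q (s n) (c n)" for n using that zero by (simp add: s_def c_def)
    ultimately show ?thesis using sums[of s c "x + y"] by (simp add: s_def c_def sums_iff)
  qed
  define S where "S = (\<lambda>m::nat. {x. Q x (real m)})"
  have cover: "(\<Union>m. closure (S m)) = UNIV"
  proof (intro set_eqI iffI UNIV_I)
    fix x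
    obtain C where "Q x C" using ex by blast
    then have "Q x (real (nat \<lceil>C\<rceil>))" using mono real_nat_ceiling_ge by blast
    then show "x \<in> (\<Union>m. closure (S m))" using closure_subset by (fastforce simp: S_def)
  qed
  \<comment> \<open>The closed sets \<open>closure (S m)\<close> cover a complete space, so by Baire
    one of them contains a ball. The sets \<open>S m\<close> themselves need not be closed.\<close>
  have "\<exists>m. interior (closure (S m)) \<noteq> {}"
  proof (rule ccontr)
    assume *: "\<not> ?thesis"
    have "euclidean interior_of \<Union>(range (\<lambda>m. closure (S m))) = {}"
      using * by (intro Baire_category_alt) (auto simp: completely_metrizable_space_euclidean)
    then show False using cover by simp
  qed
  then obtain m a where "a \<in> interior (closure (S m))" by blast
  then obtain e where e: "0 < e" "ball a e \<subseteq> closure (S m)"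
    by (meson mem_interior)
  \<comment> \<open>Symmetry and convexity of \<open>S m\<close> recentre the ball at 0 with the
    same \<open>m\<close>: \<open>x\<close> is half the difference of \<open>a + x\<close> and
    \<open>a - x\<close>.\<close>
  have "ball 0 e \<subseteq> closure (S m)"
  proof
    fix x :: 'a assume "x \<in> ball 0 e"
    then have "a + x \<in> closure (S m)" "a - x \<in> closure (S m)" using e by (auto simp: dist_norm)
    then obtain s t where s: "\<And>k. s k \<in> S m" "s \<longlonglongrightarrow> a + x" and t: "\<And>k. t k \<in> S m" "t \<longlonglongrightarrow> a - x"
      by (auto simp: closure_sequential)
    have "Q ((1/2) *\<^sub>R s k + (-1/2) *\<^sub>R t k) (\<bar>1/2\<bar> * real m + \<bar>-1/2\<bar> * real m)" for k
      using s(1) t(1) by (intro add scale) (auto simp: S_def)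
    then have "(1/2) *\<^sub>R s k + (-1/2) *\<^sub>R t k \<in> S m" for k
      by (simp add: S_def)
    moreover have "(\<lambda>k. (1/2) *\<^sub>R s k + (-1/2) *\<^sub>R t k) \<longlonglongrightarrow> (1/2) *\<^sub>R (a + x) + (-1/2) *\<^sub>R (a - x)"
      by (intro tendsto_intros s t)
    moreover have "(1/2) *\<^sub>R (a + x) + (-1/2) *\<^sub>R (a - x) = x"
      by (simp add: algebra_simps flip: scaleR_add_left)
    ultimately show "x \<in> closure (S m)"
      unfolding closure_sequential by (intro exI[of _ "\<lambda>k. (1/2) *\<^sub>R s k + (-1/2) *\<^sub>R t k"]) simp
  qed
  \<comment> \<open>Approximating \<open>2 ^ j *\<^sub>R x\<close> within \<open>e / 2\<close> and
    scaling back halves the remainder at the cost \<open>m / 2 ^ j\<close>.\<close>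
  then have approx: "\<exists>y. norm y < e / 2 ^ Suc j \<and> Q (x - y) (real m / 2 ^ j)"
    if "norm x < e / 2 ^ j" for x j
  proof -
    have "norm (2 ^ j *\<^sub>R x) < e" using that by (simp add: field_simps)
    then have "2 ^ j *\<^sub>R x \<in> closure (S m)" using \<open>ball 0 e \<subseteq> _\<close> by auto
    then obtain s where s: "s \<in> S m" "dist s (2 ^ j *\<^sub>R x) < e / 2"
      unfolding closure_approachable using e(1) by (meson half_gt_zero)
    have "norm (x - (1 / 2 ^ j) *\<^sub>R s) = norm ((1 / 2 ^ j) *\<^sub>R (2 ^ j *\<^sub>R x - s))"
      by (simp add: algebra_simps)
    also have "\<dots> = dist s (2 ^ j *\<^sub>R x) / 2 ^ j" by (simp add: dist_norm norm_minus_commute)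
    also have "\<dots> < e / 2 ^ Suc j" using s(2) by (simp add: field_simps)
    finally have "norm (x - (1 / 2 ^ j) *\<^sub>R s) < e / 2 ^ Suc j" .
    moreover have "Q ((1 / 2 ^ j) *\<^sub>R s) (\<bar>1 / 2 ^ j\<bar> * real m)"
      using s(1) by (intro scale) (simp add: S_def)
    ultimately show ?thesis
      by (intro exI[of _ "x - (1 / 2 ^ j) *\<^sub>R s"]) simp
  qed
  have small: "Q x (2 * real m)" if x: "norm x < e" for x
  proof -
    \<comment> \<open>The closure is removed by iterating \<open>approx\<close>: the remainders
      \<open>r j\<close> start at \<open>x\<close> and tend to 0, so their differences telescope to
      \<open>x\<close>, and the costs sum to \<open>2 * m\<close>. The clause for
      \<open>j = 0\<close> pins the starting point in the dependent choice.\<close>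
    define P where "P = (\<lambda>j z. norm z < e / 2 ^ j \<and> (j = 0 \<longrightarrow> z = x))"
    have "\<exists>r. \<forall>j. P j (r j) \<and> Q (r j - r (Suc j)) (real m / 2 ^ j)"
    proof (rule dependent_nat_choice)
      show "\<exists>z. P 0 z" using x by (simp add: P_def)
    next
      fix z j assume "P j z"
      then show "\<exists>y. P (Suc j) y \<and> Q (z - y) (real m / 2 ^ j)"
        using approx[of z j] by (auto simp: P_def)
    qed
    then obtain r where r: "\<And>j. P j (r j)" "\<And>j. Q (r j - r (Suc j)) (real m / 2 ^ j)" by blast
    have "r \<longlonglongrightarrow> 0"
    proof (rule Lim_null_comparison)
      show "\<forall>\<^sub>F j in sequentially. norm (r j) \<le> e * (1 / 2) ^ j"
        using r(1) by (intro always_eventually) (auto simp: P_def power_one_over field_simps intro: less_imp_le)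
      show "(\<lambda>j. e * (1 / 2) ^ j) \<longlonglongrightarrow> 0"
        by (intro tendsto_mult_right_zero LIMSEQ_realpow_zero) auto
    qed
    then have "(\<lambda>j. r j - r (Suc j)) sums (r 0 - 0)" by (rule telescope_sums')
    moreover have "r 0 = x" using r(1)[of 0] by (simp add: P_def)
    moreover have "(\<lambda>j. real m / 2 ^ j) sums (real m * 2)"
      using sums_mult[OF geometric_sums[of "1/2::real"], of "real m"] by (simp add: power_one_over field_simps)
    ultimately show ?thesis
      using sums[of "\<lambda>j. r j - r (Suc j)" "\<lambda>j. real m / 2 ^ j" x] r(2) by (simp add: sums_iff mult.commute)
  qed
  \<comment> \<open>The factor \<open>e / 2\<close> instead of \<open>e\<close> makes the norm
    strictly smaller than \<open>e\<close>.\<close>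
  have "Q x (\<bar>2 / e\<bar> * (2 * real m))" if "norm x \<le> 1" for x
  proof -
    have "norm ((e / 2) *\<^sub>R x) \<le> e / 2 * 1"
      using e(1) that by (simp add: mult_left_le)
    also have "\<dots> < e" using e(1) by simp
    finally have "Q ((2 / e) *\<^sub>R (e / 2) *\<^sub>R x) (\<bar>2 / e\<bar> * (2 * real m))"
      by (intro scale small)
    then show ?thesis using e(1) by simp
  qed
  then show ?thesis by blast
qed

text \<open>Stands in for the closedness of finite-dimensional subspaces when only pointwise
  convergence on a set is available. Induction on \<open>F\<close>: a function \<open>v j\<close>
  that depends on the others on \<open>X\<close> is absorbed into them; otherwise its coefficients
  have a bounded subsequence.\<close>

lemma span_closed_pointwise:
  fixes v :: "'i \<Rightarrow> 'x \<Rightarrow> complex"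
  assumes "finite F"
    and "\<And>x. x \<in> X \<Longrightarrow> (\<lambda>k. \<Sum>i\<in>F. c k i * v i x) \<longlonglongrightarrow> y x"
  shows "\<exists>a. \<forall>x\<in>X. y x = (\<Sum>i\<in>F. a i * v i x)"
  using assms
proof (induction F arbitrary: c y rule: finite_induct)
  case empty
  then show ?case by (auto intro: LIMSEQ_unique)
next
  case (insert j F)
  have lim: "(\<lambda>k. c k j * v j x + (\<Sum>i\<in>F. c k i * v i x)) \<longlonglongrightarrow> y x" if "x \<in> X" for x
    using insert.prems[OF that] insert.hyps by simp
  show ?case
  proof (cases "\<exists>b. \<forall>x\<in>X. v j x = (\<Sum>i\<in>F. b i * v i x)")
    case True
    then obtain b where b: "\<And>x. x \<in> X \<Longrightarrow> v j x = (\<Sum>i\<in>F. b i * v i x)" by blast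
    have "(\<lambda>k. \<Sum>i\<in>F. (c k j * b i + c k i) * v i x) \<longlonglongrightarrow> y x" if "x \<in> X" for x
      using lim[OF that] unfolding b[OF that]
      by (simp add: sum_distrib_left sum.distrib distrib_right mult.assoc)
    then obtain a where "\<And>x. x \<in> X \<Longrightarrow> y x = (\<Sum>i\<in>F. a i * v i x)"
      using insert.IH[of "\<lambda>k i. c k j * b i + c k i" y] by blast
    then show ?thesis
      using insert.hyps by (intro exI[of _ "a(j := 0)"]) (auto intro!: sum.cong)
  next
    case False
    \<comment> \<open>If the coefficients of \<open>v j\<close> tend to infinity, dividing by them exhibits \<open>v j\<close> as a limit of
      combinations of the remaining functions.\<close>
    have "\<not> filterlim (\<lambda>k. c k j) at_infinity sequentially"
    proof
      assume inf: "filterlim (\<lambda>k. c k j) at_infinity sequentially"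
      have "(\<lambda>k. \<Sum>i\<in>F. (- c k i / c k j) * v i x) \<longlonglongrightarrow> v j x" if x: "x \<in> X" for x
      proof -
        have "(\<lambda>k. v j x - (c k j * v j x + (\<Sum>i\<in>F. c k i * v i x)) * inverse (c k j)) \<longlonglongrightarrow> v j x - y x * 0"
          by (intro tendsto_intros lim x filterlim_compose[OF tendsto_inverse_0 inf])
        moreover have "\<forall>\<^sub>F k in sequentially. c k j \<noteq> 0"
          using inf by (rule filterlim_at_infinity_imp_eventually_ne)
        then have "\<forall>\<^sub>F k in sequentially. v j x - (c k j * v j x + (\<Sum>i\<in>F. c k i * v i x)) * inverse (c k j)
            = (\<Sum>i\<in>F. (- c k i / c k j) * v i x)"
          by eventually_elim (simp add: field_simps sum_negf sum_divide_distrib sum_distrib_right)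
        ultimately show ?thesis by (simp add: tendsto_cong)
      qed
      then show False using insert.IH[of "\<lambda>k i. - c k i / c k j" "v j"] False by blast
    qed
    \<comment> \<open>Infinitely many coefficients of \<open>v j\<close> have norm below
      \<open>R\<close>. Bolzano-Weierstrass gives a limit \<open>l\<close> along a subsequence, and
      subtracting \<open>l * v j x\<close> leaves a limit of combinations over
      \<open>F\<close>.\<close>
    then obtain R where "\<not> (\<forall>\<^sub>F k in sequentially. R \<le> norm (c k j))"
      by (auto simp: filterlim_at_infinity[OF order_refl])
    then obtain r :: "nat \<Rightarrow> nat" where r: "strict_mono r" "\<And>k. norm (c (r k) j) < R"
      using not_eventually_sequentiallyD by (metis not_le)
    have "bounded (range (\<lambda>k. c (r k) j))" using r(2) by (auto simp: bounded_iff intro!: exI[of _ R] less_imp_le)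
    then obtain l s where s: "strict_mono s" "((\<lambda>k. c (r k) j) \<circ> s) \<longlonglongrightarrow> l"
      using bounded_imp_convergent_subsequence by blast
    have "(\<lambda>k. \<Sum>i\<in>F. c (r (s k)) i * v i x) \<longlonglongrightarrow> y x - l * v j x" if x: "x \<in> X" for x
    proof -
      have "(\<lambda>k. (c (r (s k)) j * v j x + (\<Sum>i\<in>F. c (r (s k)) i * v i x)) - c (r (s k)) j * v j x) \<longlonglongrightarrow> y x - l * v j x"
        using LIMSEQ_subseq_LIMSEQ[OF lim[OF x] strict_mono_o[OF r(1) s(1)]] s(2)
        by (intro tendsto_intros) (auto simp: o_def)
      then show ?thesis by simp
    qed
    then obtain a where a: "\<And>x. x \<in> X \<Longrightarrow> y x - l * v j x = (\<Sum>i\<in>F. a i * v i x)"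
      using insert.IH[of "\<lambda>k. c (r (s k))" "\<lambda>x. y x - l * v j x"] by blast
    have "y x = (\<Sum>i\<in>insert j F. (a(j := l)) i * v i x)" if x: "x \<in> X" for x
    proof -
      have "y x = l * v j x + (\<Sum>i\<in>F. a i * v i x)" using a[OF x] by (simp add: algebra_simps)
      also have "(\<Sum>i\<in>F. a i * v i x) = (\<Sum>i\<in>F. (a(j := l)) i * v i x)"
        using insert.hyps by (intro sum.cong) auto
      finally show ?thesis using insert.hyps by simp
    qed
    then show ?thesis by blast
  qed
qed

section \<open>Powers of sums, and the classes in L^q and L^\<infinity>\<close>

lemma sum_powr_le:
  fixes a :: "'i \<Rightarrow> real"
  assumes "finite S" "0 \<le> q" "\<And>i. i \<in> S \<Longrightarrow> 0 \<le> a i"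
  shows "(\<Sum>i\<in>S. a i) powr q \<le> real (card S) powr q * (\<Sum>i\<in>S. a i powr q)"
proof (cases "S = {}")
  case False
  define m where "m = Max (a ` S)"
  have m: "m \<in> a ` S" "\<And>i. i \<in> S \<Longrightarrow> a i \<le> m" using assms(1) False by (auto simp: m_def)
  then have "(\<Sum>i\<in>S. a i) powr q \<le> (real (card S) * m) powr q"
    using assms by (intro powr_mono2 sum_bounded_above sum_nonneg) auto
  also have "\<dots> = real (card S) powr q * m powr q"
    using m(1) assms by (subst powr_mult) auto
  also have "m powr q \<le> (\<Sum>i\<in>S. a i powr q)"
    using m(1) assms by (auto intro!: member_le_sum)
  finally show ?thesis by (simp add: mult_left_mono)
qed simp

lemma limitin_Lp_iff:
  assumes q: "1 \<le> q" and f: "\<And>k::nat. f k \<in> borel_measurable M" "\<And>k. ae_class M (f k) \<in> Lp_space M q"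
    and g: "g \<in> borel_measurable M" "ae_class M g \<in> Lp_space M q"
  shows "limitin (Lp_topology M q) (\<lambda>k. ae_class M (f k)) (ae_class M g) sequentially \<longleftrightarrow>
    (\<lambda>k. \<integral>x. cmod (f k x - g x) powr q \<partial>M) \<longlonglongrightarrow> 0"
    (is "_ \<longleftrightarrow> ?I \<longlonglongrightarrow> 0")
proof -
  have "limitin (Lp_topology M q) (\<lambda>k. ae_class M (f k)) (ae_class M g) sequentially \<longleftrightarrow>
      (\<lambda>k. ?I k powr (1 / q)) \<longlonglongrightarrow> 0"
    using f g by (simp add: Metric_space.limitin_metric_dist_null[OF Metric_space_Lp[OF q]] Lp_dist_ae_class)
  also have "\<dots> \<longleftrightarrow> ?I \<longlonglongrightarrow> 0"
  proof
    assume "(\<lambda>k. ?I k powr (1 / q)) \<longlonglongrightarrow> 0"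
    then have "(\<lambda>k. (?I k powr (1 / q)) powr q) \<longlonglongrightarrow> 0 powr q"
      using q by (intro tendsto_powr') auto
    then show "?I \<longlonglongrightarrow> 0" using q by (simp add: powr_powr)
  next
    assume "?I \<longlonglongrightarrow> 0"
    then have "(\<lambda>k. ?I k powr (1 / q)) \<longlonglongrightarrow> 0 powr (1 / q)"
      using q by (intro tendsto_powr') auto
    then show "(\<lambda>k. ?I k powr (1 / q)) \<longlonglongrightarrow> 0" by simp
  qed
  finally show ?thesis .
qed

lemma ae_class_in_Lp_space_iff:
  assumes "f \<in> borel_measurable M"
  shows "ae_class M f \<in> Lp_space M q \<longleftrightarrow> integrable M (\<lambda>x. cmod (f x) powr q)"
proof
  assume "ae_class M f \<in> Lp_space M q"
  then obtain g where g: "g \<in> borel_measurable M" "integrable M (\<lambda>x. cmod (g x) powr q)"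
    "ae_class M f = ae_class M g"
    by (auto simp: Lp_space_def)
  then have "AE x in M. f x = g x" using assms by (simp add: ae_class_eq_iff)
  then show "integrable M (\<lambda>x. cmod (f x) powr q)"
    using g(1,2) assms by (subst integrable_cong_AE[where g = "\<lambda>x. cmod (g x) powr q"])
      (auto elim: eventually_mono)
qed (use assms in \<open>auto simp: Lp_space_def\<close>)

lemma Linf_spaceE:
  assumes "F \<in> Linf_space M"
  obtains f C where "F = ae_class M f" "f \<in> borel_measurable M" "AE x in M. cmod (f x) \<le> C"
  using assms by (auto simp: Linf_space_def)

lemma Linf_spaceI:
  assumes "f \<in> borel_measurable M" "AE x in M. cmod (f x) \<le> C"
  shows "ae_class M f \<in> Linf_space M"
  using assms by (auto simp: Linf_space_def)

section \<open>The operator \<open>W\<close> and the weight \<open>J\<close>\<close>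

locale weighted_composition_sum = sigma_finite_measure M for M :: "'a measure" +
  fixes q :: real and n :: nat
    and u :: "nat \<Rightarrow> 'a \<Rightarrow> complex" and \<phi> :: "nat \<Rightarrow> 'a \<Rightarrow> 'a"
  assumes q: "1 \<le> q"
    and u[measurable]: "\<And>r. r \<in> {1..n} \<Longrightarrow> u r \<in> borel_measurable M"
    and ns: "\<And>r. r \<in> {1..n} \<Longrightarrow> nonsingular_map M (\<phi> r)"
    and subalg: "\<And>r. r \<in> {1..n} \<Longrightarrow> sigma_finite_subalgebra M (preimage_algebra M (\<phi> r))"
begin

abbreviation "W \<equiv> wco_fun n u \<phi>"
abbreviation "J \<equiv> wco_J M q n u \<phi>"
abbreviation "range_W \<equiv> wco M n u \<phi> ` Linf_space M"

lemma phi_measurable[measurable]: "r \<in> {1..n} \<Longrightarrow> \<phi> r \<in> measurable M M"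
  using ns by (auto simp: nonsingular_map_def)

lemma W_measurable[measurable]: "f \<in> borel_measurable M \<Longrightarrow> W f \<in> borel_measurable M"
  unfolding wco_fun_def
  by (intro borel_measurable_sum borel_measurable_times u measurable_compose[OF phi_measurable])

lemma wco_eq: "f \<in> borel_measurable M \<Longrightarrow> wco M n u \<phi> (ae_class M f) = ae_class M (W f)"
  by (intro wco_ae_class u ns)

lemma J_measurable[measurable]: "J \<in> borel_measurable M"
proof -
  have "cond_exp_pull M (\<phi> r) f \<in> borel_measurable M" if "r \<in> {1..n}" for r f
    using cond_exp_pull[OF ns[OF that]] by (auto simp: is_cond_exp_pull_def)
  then show ?thesis
    unfolding wco_J_def h_deriv_def by measurable
qed

text \<open>For each \<open>r\<close>, the density \<open>h_deriv M (\<phi> r)\<close> turns the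
  integral into one over the image measure, hence into an integral of
  \<open>F (\<phi> r x) * g (\<phi> r x)\<close>. There \<open>F (\<phi> r x)\<close> is the
  conditional expectation of the weight, which can be replaced by the weight itself because
  \<open>g (\<phi> r x)\<close> is measurable for the preimage algebra.\<close>

lemma nn_integral_J:
  assumes [measurable]: "g \<in> borel_measurable M"
  shows "(\<integral>\<^sup>+x. J x * g x \<partial>M) = (\<Sum>r=1..n. \<integral>\<^sup>+x. ennreal (cmod (u r x) powr q) * g (\<phi> r x) \<partial>M)"
proof -
  have *: "(\<integral>\<^sup>+x. h_deriv M (\<phi> r) x * cond_exp_pull M (\<phi> r) (\<lambda>y. ennreal (cmod (u r y) powr q)) x * g x \<partial>M)
      = (\<integral>\<^sup>+x. ennreal (cmod (u r x) powr q) * g (\<phi> r x) \<partial>M)"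
    and [measurable]: "cond_exp_pull M (\<phi> r) (\<lambda>y. ennreal (cmod (u r y) powr q)) \<in> borel_measurable M"
    if r[measurable]: "r \<in> {1..n}" for r
  proof -
    define w where "w = (\<lambda>y. ennreal (cmod (u r y) powr q))"
    define F where "F = cond_exp_pull M (\<phi> r) w"
    have [measurable]: "w \<in> borel_measurable M" "h_deriv M (\<phi> r) \<in> borel_measurable M"
      by (simp_all add: w_def h_deriv_def)
    have F[measurable]: "F \<in> borel_measurable M"
      and AE: "AE x in M. nn_cond_exp M (preimage_algebra M (\<phi> r)) w x = F (\<phi> r x)"
      using cond_exp_pull[OF ns[OF r]] by (auto simp: is_cond_exp_pull_def F_def)
    then show "cond_exp_pull M (\<phi> r) (\<lambda>y. ennreal (cmod (u r y) powr q)) \<in> borel_measurable M"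
      by (simp add: F_def w_def)
    interpret sigma_finite_subalgebra M "preimage_algebra M (\<phi> r)" by (rule subalg[OF r])
    have dens: "density M (h_deriv M (\<phi> r)) = distr M M (\<phi> r)"
      unfolding h_deriv_def using ns[OF r] by (intro density_RN_deriv) (auto simp: nonsingular_map_def)
    have "(\<integral>\<^sup>+x. h_deriv M (\<phi> r) x * F x * g x \<partial>M) = (\<integral>\<^sup>+x. F x * g x \<partial>density M (h_deriv M (\<phi> r)))"
      by (subst nn_integral_density) (auto simp: mult.assoc)
    also have "\<dots> = (\<integral>\<^sup>+x. F (\<phi> r x) * g (\<phi> r x) \<partial>M)"
      unfolding dens by (subst nn_integral_distr) auto
    also have "\<dots> = (\<integral>\<^sup>+x. g (\<phi> r x) * nn_cond_exp M (preimage_algebra M (\<phi> r)) w x \<partial>M)"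
      using AE by (intro nn_integral_cong_AE) (auto simp: mult.commute elim: eventually_mono)
    also have "\<dots> = (\<integral>\<^sup>+x. g (\<phi> r x) * w x \<partial>M)"
    proof (rule nn_cond_exp_intg)
      have "\<phi> r \<in> measurable (preimage_algebra M (\<phi> r)) M"
        unfolding preimage_algebra_def
        using measurable_space[OF phi_measurable[OF r]] by (intro measurable_vimage_algebra1) auto
      then show "(\<lambda>x. g (\<phi> r x)) \<in> borel_measurable (preimage_algebra M (\<phi> r))" by measurable
    qed simp
    finally show "(\<integral>\<^sup>+x. h_deriv M (\<phi> r) x * cond_exp_pull M (\<phi> r) (\<lambda>y. ennreal (cmod (u r y) powr q)) x * g x \<partial>M)
      = (\<integral>\<^sup>+x. ennreal (cmod (u r x) powr q) * g (\<phi> r x) \<partial>M)"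
      by (simp add: F_def w_def mult.commute)
  qed
  have [measurable]: "h_deriv M (\<phi> r) \<in> borel_measurable M" for r by (simp add: h_deriv_def)
  have "(\<integral>\<^sup>+x. J x * g x \<partial>M) = (\<Sum>r=1..n. \<integral>\<^sup>+x. h_deriv M (\<phi> r) x *
      cond_exp_pull M (\<phi> r) (\<lambda>y. ennreal (cmod (u r y) powr q)) x * g x \<partial>M)"
    unfolding wco_J_def sum_distrib_right by (intro nn_integral_sum) measurable
  then show ?thesis using * by simp
qed

text \<open>Acts as boundedness of \<open>W\<close> from L^q with weight \<open>J\<close> to L^q. In
  extended values it also covers unbounded \<open>g\<close>, where the right side may be
  infinite.\<close>

lemma nn_integral_W_le:
  assumes [measurable]: "g \<in> borel_measurable M"
  shows "(\<integral>\<^sup>+x. ennreal (cmod (W g x) powr q) \<partial>M)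
    \<le> ennreal (real n powr q) * (\<integral>\<^sup>+x. J x * ennreal (cmod (g x) powr q) \<partial>M)"
proof -
  have "(\<integral>\<^sup>+x. ennreal (cmod (W g x) powr q) \<partial>M) \<le>
      (\<integral>\<^sup>+x. ennreal (real n powr q) * (\<Sum>r=1..n. ennreal (cmod (u r x) powr q) * ennreal (cmod (g (\<phi> r x)) powr q)) \<partial>M)"
  proof (rule nn_integral_mono)
    fix x
    have "cmod (W g x) powr q \<le> (\<Sum>r=1..n. cmod (u r x) * cmod (g (\<phi> r x))) powr q"
      unfolding wco_fun_def using q by (intro powr_mono2 sum_norm_le) (auto simp: norm_mult)
    also have "\<dots> \<le> real (card {1..n}) powr q * (\<Sum>r=1..n. (cmod (u r x) * cmod (g (\<phi> r x))) powr q)"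
      using q by (intro sum_powr_le) auto
    finally show "ennreal (cmod (W g x) powr q) \<le> ennreal (real n powr q) * (\<Sum>r=1..n. ennreal (cmod (u r x) powr q) * ennreal (cmod (g (\<phi> r x)) powr q))"
      by (simp add: powr_mult sum_nonneg flip: ennreal_mult)
  qed
  also have "\<dots> = ennreal (real n powr q) * (\<Sum>r=1..n. \<integral>\<^sup>+x. ennreal (cmod (u r x) powr q) * ennreal (cmod (g (\<phi> r x)) powr q) \<partial>M)"
    by (subst nn_integral_cmult, measurable) (subst nn_integral_sum, auto)
  also have "\<dots> = ennreal (real n powr q) * (\<integral>\<^sup>+x. J x * ennreal (cmod (g x) powr q) \<partial>M)"
    by (subst nn_integral_J) auto
  finally show ?thesis .
qed

text \<open>Values of a function on the set where \<open>J\<close> vanishes do not influence its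
  image, since \<open>nn_integral_W_le\<close> ignores them.\<close>

lemma W_eq_0_AE:
  assumes [measurable]: "g \<in> borel_measurable M" and 0: "AE x in M. J x = 0 \<or> g x = 0"
  shows "AE x in M. W g x = 0"
proof -
  have "(\<integral>\<^sup>+x. J x * ennreal (cmod (g x) powr q) \<partial>M) = (\<integral>\<^sup>+x. 0 \<partial>M)"
    using 0 by (intro nn_integral_cong_AE) (auto elim!: eventually_mono)
  then have "(\<integral>\<^sup>+x. ennreal (cmod (W g x) powr q) \<partial>M) = 0"
    using nn_integral_W_le[of g] by simp
  then show ?thesis by (subst (asm) nn_integral_0_iff_AE) auto
qed

lemma W_sum: "W (\<lambda>x. \<Sum>i\<in>F. a i * f i x) x = (\<Sum>i\<in>F. a i * W (f i) x)"
  unfolding wco_fun_def by (subst sum_distrib_left)+ (subst sum.swap, simp add: sum_distrib_left mult.left_commute)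

lemma W_diff: "W (\<lambda>x. f x - g x) x = W f x - W g x"
  by (simp add: wco_fun_def right_diff_distrib sum_subtractf)

section \<open>Consequences of closed range and injectivity\<close>

text \<open>The truncations of \<open>g\<close> are bounded and converge to \<open>g\<close> in the
  \<open>J\<close>-weighted norm, so their images converge to \<open>W g\<close> in L^q and
  closedness keeps the limit in the range.\<close>

lemma W_range_of_J_integrable:
  assumes clo: "closedin (Lp_topology M q) range_W"
    and [measurable]: "g \<in> borel_measurable M"
    and fin: "(\<integral>\<^sup>+x. J x * ennreal (cmod (g x) powr q) \<partial>M) < \<infinity>"
  obtains f C where "f \<in> borel_measurable M" "AE x in M. cmod (f x) \<le> C" "AE x in M. W f x = W g x"
proof -
  interpret Lp: Metric_space "Lp_space M q" "Lp_dist M q" by (rule Metric_space_Lp[OF q])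
  \<comment> \<open>Large values are replaced by 0, so \<open>g' N x - g x\<close> is dominated by
    \<open>g x\<close> and vanishes as soon as \<open>N\<close> reaches
    \<open>cmod (g x)\<close>.\<close>
  define g' where "g' = (\<lambda>(N::nat) x. if cmod (g x) \<le> real N then g x else 0)"
  have [measurable]: "g' N \<in> borel_measurable M" for N unfolding g'_def by measurable
  have class_Lp: "ae_class M (W h) \<in> Lp_space M q"
    if [measurable]: "h \<in> borel_measurable M" and "(\<integral>\<^sup>+x. J x * ennreal (cmod (h x) powr q) \<partial>M) < \<infinity>" for h
    using nn_integral_W_le[OF that(1)] that(2)
    by (subst ae_class_in_Lp_space_iff) (auto intro!: integrableI_bounded simp: ennreal_mult_less_top intro: le_less_trans)
  have g'_le: "(\<integral>\<^sup>+x. J x * ennreal (cmod (g' N x) powr q) \<partial>M) \<le> (\<integral>\<^sup>+x. J x * ennreal (cmod (g x) powr q) \<partial>M)" for N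
    by (intro nn_integral_mono mult_left_mono) (auto simp: g'_def)
  have g'_Lp: "ae_class M (W (g' N)) \<in> Lp_space M q" for N
    using g'_le fin by (intro class_Lp) (auto intro: le_less_trans)
  have "(\<lambda>N. \<integral>\<^sup>+x. J x * ennreal (cmod (g' N x - g x) powr q) \<partial>M) \<longlonglongrightarrow> (\<integral>\<^sup>+x. 0 \<partial>M)"
  proof (rule nn_integral_dominated_convergence[OF _ _ _ _ fin])
    show "AE x in M. J x * ennreal (cmod (g' N x - g x) powr q) \<le> J x * ennreal (cmod (g x) powr q)" for N
      by (intro AE_I2 mult_left_mono) (auto simp: g'_def)
    show "AE x in M. (\<lambda>N. J x * ennreal (cmod (g' N x - g x) powr q)) \<longlonglongrightarrow> 0"
    proof (intro AE_I2 tendsto_eventually)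
      fix x
      show "\<forall>\<^sub>F N in sequentially. J x * ennreal (cmod (g' N x - g x) powr q) = 0"
        using eventually_ge_at_top[of "nat \<lceil>cmod (g x)\<rceil>"]
        by eventually_elim (simp add: g'_def nat_le_iff ceiling_le_iff)
    qed
  qed measurable
  then have "(\<lambda>N. ennreal (real n powr q) * (\<integral>\<^sup>+x. J x * ennreal (cmod (g' N x - g x) powr q) \<partial>M))
      \<longlonglongrightarrow> ennreal (real n powr q) * (\<integral>\<^sup>+x. 0 \<partial>M)"
    by (intro ennreal_tendsto_cmult) auto
  then have lim: "(\<lambda>N. ennreal (real n powr q) * (\<integral>\<^sup>+x. J x * ennreal (cmod (g' N x - g x) powr q) \<partial>M))
      \<longlonglongrightarrow> 0"
    by simp
  have "(\<lambda>N. \<integral>\<^sup>+x. ennreal (cmod (W (g' N) x - W g x) powr q) \<partial>M) \<longlonglongrightarrow> 0"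
  proof (rule tendsto_sandwich[OF _ _ tendsto_const lim])
    have "(\<integral>\<^sup>+x. ennreal (cmod (W (g' N) x - W g x) powr q) \<partial>M)
        \<le> ennreal (real n powr q) * (\<integral>\<^sup>+x. J x * ennreal (cmod (g' N x - g x) powr q) \<partial>M)" for N
      using nn_integral_W_le[of "\<lambda>x. g' N x - g x"] by (simp add: W_diff)
    then show "\<forall>\<^sub>F N in sequentially. (\<integral>\<^sup>+x. ennreal (cmod (W (g' N) x - W g x) powr q) \<partial>M)
        \<le> ennreal (real n powr q) * (\<integral>\<^sup>+x. J x * ennreal (cmod (g' N x - g x) powr q) \<partial>M)"
      by (intro always_eventually allI)
  qed simp
  then have "(\<lambda>N. enn2real (\<integral>\<^sup>+x. ennreal (cmod (W (g' N) x - W g x) powr q) \<partial>M)) \<longlonglongrightarrow> enn2real 0"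
    by (intro tendsto_enn2real) simp_all
  then have "limitin Lp.mtopology (\<lambda>N. ae_class M (W (g' N))) (ae_class M (W g)) sequentially"
    using fin by (subst limitin_Lp_iff) (auto intro!: q g'_Lp class_Lp simp: integral_eq_nn_integral)
  moreover have "range (\<lambda>N. ae_class M (W (g' N))) \<subseteq> range_W"
  proof (intro image_subsetI)
    fix N
    have "ae_class M (g' N) \<in> Linf_space M"
      by (rule Linf_spaceI[of _ _ "real N"]) (auto simp: g'_def)
    then show "ae_class M (W (g' N)) \<in> range_W"
      by (metis image_eqI wco_eq \<open>g' N \<in> borel_measurable M\<close>)
  qed
  ultimately have "ae_class M (W g) \<in> range_W"
    using clo by (auto simp: Lp.metric_closedin_iff_sequentially_closed)
  then obtain f C where f: "f \<in> borel_measurable M" "AE x in M. cmod (f x) \<le> C"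
    "ae_class M (W g) = wco M n u \<phi> (ae_class M f)"
    by (auto elim!: Linf_spaceE)
  then have "AE x in M. W g x = W f x"
    by (subst ae_class_eq_iff[symmetric]) (auto simp: wco_eq)
  then show ?thesis using f by (intro that[of f C]) (auto elim: eventually_mono)
qed

lemma W_sums:
  assumes "\<And>r. r \<in> {1..n} \<Longrightarrow> (\<lambda>k. f k (\<phi> r x)) sums g (\<phi> r x)"
  shows "(\<lambda>k. W (f k) x) sums W g x"
  unfolding wco_fun_def using assms by (intro sums_sum sums_mult) auto

text \<open>The weights match the heights \<open>Suc k\<close> of \<open>G d\<close> on
  \<open>D k\<close>: convergence would make every \<open>G d\<close> integrable to the power
  \<open>q\<close> against \<open>J\<close>. The resulting uniform bound on bounded solutions
  contradicts the unbounded heights.\<close>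

lemma disjoint_sequence_J_not_summable:
  assumes clo: "closedin (Lp_topology M q) range_W"
    and inj: "inj_on (wco M n u \<phi>) (Linf_space M)"
    and D[measurable]: "\<And>k. D k \<in> sets M" and pos: "\<And>k. 0 < emeasure M (D k)"
    and disj: "disjoint_family D"
  shows "(\<Sum>k. ennreal (real (Suc k) powr q) * (\<integral>\<^sup>+x\<in>D k. J x \<partial>M)) = \<infinity>"
proof (rule ccontr)
  assume inf: "\<not> ?thesis"
  have ind: "indicator (D j) x = of_bool (j = k)" if "x \<in> D k" for x j k
    using that disj by (auto simp: disjoint_family_on_def indicator_def)
  define G where "G = (\<lambda>d x. \<Sum>k. of_nat (Suc k) * apply_bcontfun d (discrete k) * indicator (D k) x :: complex)"
  have G_in: "G d x = of_nat (Suc k) * d (discrete k)" if "x \<in> D k" for d x k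
    unfolding G_def by (subst suminf_finite[of "{k}"]) (auto simp: ind[OF that])
  have G_out: "G d x = 0" if "\<And>k. x \<notin> D k" for d x
    using that by (simp add: G_def)
  have [measurable]: "G d \<in> borel_measurable M" for d
    unfolding G_def by measurable
  \<comment> \<open>The Banach space \<open>nat discrete \<Rightarrow>\<^sub>C complex\<close> serves as \<open>\<ell>\<^sup>\<infinity>\<close>. For \<open>d\<close> in it, \<open>G d\<close> is
    unbounded in general, but \<open>W (G d)\<close> agrees with the image of some bounded function.\<close>
  define Q where "Q = (\<lambda>(d :: nat discrete \<Rightarrow>\<^sub>C complex) C.
    \<exists>f \<in> borel_measurable M. (AE x in M. cmod (f x) \<le> C) \<and> (AE x in M. W f x = W (G d) x))"
  have QI: "Q d C" if "f \<in> borel_measurable M" "AE x in M. cmod (f x) \<le> C" "AE x in M. W f x = W (G d) x"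
    for f d C
    unfolding Q_def using that by (intro bexI[of _ f] conjI)
  have "\<exists>C. \<forall>d. norm d \<le> 1 \<longrightarrow> Q d C"
  proof (rule countably_subadditive_bounded[of Q])
    fix d :: "nat discrete \<Rightarrow>\<^sub>C complex"
    \<comment> \<open>Since the \<open>D k\<close> are disjoint, at each point at most one term of
      the series survives, and it is bounded through \<open>norm d\<close>.\<close>
    have "(\<integral>\<^sup>+x. J x * ennreal (cmod (G d x) powr q) \<partial>M) \<le>
        (\<integral>\<^sup>+x. ennreal (norm d powr q) * (\<Sum>k. ennreal (real (Suc k) powr q) * (J x * indicator (D k) x)) \<partial>M)"
    proof (rule nn_integral_mono)
      fix x
      show "J x * ennreal (cmod (G d x) powr q) \<le>
          ennreal (norm d powr q) * (\<Sum>k. ennreal (real (Suc k) powr q) * (J x * indicator (D k) x))"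
      proof (cases "\<exists>k. x \<in> D k")
        case True
        then obtain k where k: "x \<in> D k" by blast
        have "cmod (G d x) powr q = real (Suc k) powr q * cmod (d (discrete k)) powr q"
          by (simp add: G_in[OF k] norm_mult powr_mult del: of_nat_Suc)
        also have "\<dots> \<le> real (Suc k) powr q * norm d powr q"
          using q by (intro mult_left_mono powr_mono2 norm_bounded) auto
        finally have "J x * ennreal (cmod (G d x) powr q) \<le> J x * ennreal (real (Suc k) powr q * norm d powr q)"
          by (intro mult_left_mono ennreal_leI) auto
        also have "\<dots> = ennreal (norm d powr q) * (ennreal (real (Suc k) powr q) * (J x * indicator (D k) x))"
          using k by (simp add: ennreal_mult mult_ac)
        also have "ennreal (real (Suc k) powr q) * (J x * indicator (D k) x) =
            (\<Sum>k. ennreal (real (Suc k) powr q) * (J x * indicator (D k) x))"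
          by (subst suminf_finite[of "{k}"]) (auto simp: ind[OF k])
        finally show ?thesis .
      qed (use q G_out in auto)
    qed
    also have "\<dots> = ennreal (norm d powr q) * (\<Sum>k. ennreal (real (Suc k) powr q) * (\<integral>\<^sup>+x\<in>D k. J x \<partial>M))"
      by (simp add: nn_integral_cmult nn_integral_suminf)
    also have "\<dots> < \<infinity>" using inf by (auto simp: ennreal_mult_less_top less_top)
    finally obtain f C where "f \<in> borel_measurable M" "AE x in M. cmod (f x) \<le> C" "AE x in M. W f x = W (G d) x"
      by (rule W_range_of_J_integrable[OF clo \<open>G d \<in> borel_measurable M\<close>])
    then have "Q d C" by (rule QI)
    then show "\<exists>C. Q d C" ..
  next
    fix d C C' assume "Q d C" "C \<le> C'"
    then obtain f where "f \<in> borel_measurable M" "AE x in M. W f x = W (G d) x"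
      and le: "AE x in M. cmod (f x) \<le> C"
      by (auto simp: Q_def)
    moreover have "AE x in M. cmod (f x) \<le> C'"
      using le by eventually_elim (use \<open>C \<le> C'\<close> in simp)
    ultimately show "Q d C'" by (intro QI[of f])
  next
    fix d C and t :: real assume "Q d C"
    then obtain f where f[measurable]: "f \<in> borel_measurable M"
      and le: "AE x in M. cmod (f x) \<le> C" and eq: "AE x in M. W f x = W (G d) x"
      by (auto simp: Q_def)
    have "G (t *\<^sub>R d) x = of_real t * G d x" for x
      by (cases "\<exists>k. x \<in> D k") (auto simp: G_in G_out scaleR_conv_of_real)
    then have "W (G (t *\<^sub>R d)) x = of_real t * W (G d) x" for x
      by (simp add: wco_fun_def sum_distrib_left mult_ac)
    moreover have "W (\<lambda>x. of_real t * f x) x = of_real t * W f x" for x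
      by (simp add: wco_fun_def sum_distrib_left mult_ac)
    ultimately have "AE x in M. W (\<lambda>x. of_real t * f x) x = W (G (t *\<^sub>R d)) x"
      using eq by simp
    moreover have "AE x in M. cmod (of_real t * f x) \<le> \<bar>t\<bar> * C"
      using le by eventually_elim (simp add: norm_mult mult_left_mono)
    moreover have "(\<lambda>x. of_real t * f x) \<in> borel_measurable M"
      using f by (intro borel_measurable_times borel_measurable_const)
    ultimately show "Q (t *\<^sub>R d) (\<bar>t\<bar> * C)"
      by (intro QI[of "\<lambda>x. of_real t * f x"])
  next
    fix s :: "nat \<Rightarrow> nat discrete \<Rightarrow>\<^sub>C complex" and d c
    assume Q: "\<And>k. Q (s k) (c k)" and s: "s sums d" and c: "summable c"
    have "\<exists>f. \<forall>k. f k \<in> borel_measurable M \<and> (AE x in M. cmod (f k x) \<le> c k) \<and>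
        (AE x in M. W (f k) x = W (G (s k)) x)"
      by (rule choice) (use Q in \<open>simp add: Q_def Bex_def\<close>)
    then obtain f where "\<forall>k. f k \<in> borel_measurable M \<and> (AE x in M. cmod (f k x) \<le> c k) \<and>
        (AE x in M. W (f k) x = W (G (s k)) x)" ..
    then have f[measurable]: "f k \<in> borel_measurable M"
      and le: "AE x in M. cmod (f k x) \<le> c k" and eq: "AE x in M. W (f k) x = W (G (s k)) x" for k
      by simp_all
    have "AE x in M. \<forall>k. cmod (f k x) \<le> c k" unfolding AE_all_countable using le by blast
    then have sums: "AE x in M. (\<lambda>k. f k x) sums (\<Sum>k. f k x) \<and> cmod (\<Sum>k. f k x) \<le> (\<Sum>k. c k)"
    proof eventually_elim
      case (elim x)
      then have *: "summable (\<lambda>k. cmod (f k x))"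
        by (intro summable_comparison_test'[OF c]) auto
      then have "cmod (\<Sum>k. f k x) \<le> (\<Sum>k. cmod (f k x))" by (rule summable_norm)
      also have "\<dots> \<le> (\<Sum>k. c k)" using elim * c by (intro suminf_le) auto
      finally show ?case using summable_norm_cancel[OF *] by (simp add: summable_sums)
    qed
    have bound: "AE x in M. cmod (\<Sum>k. f k x) \<le> (\<Sum>k. c k)"
      using sums by eventually_elim simp
    \<comment> \<open>Evaluation at a coordinate is continuous, so convergence in norm gives
      convergence of each coordinate and hence of \<open>G (s j) x\<close> at every
      \<open>x\<close>.\<close>
    have "bounded_linear (\<lambda>g :: nat discrete \<Rightarrow>\<^sub>C complex. g k)" for k
      by (rule bounded_linear_intro[of _ 1]) (auto simp: norm_bounded)
    then have "(\<lambda>j. s j (discrete k)) sums d (discrete k)" for k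
      using s by (rule bounded_linear.sums)
    then have G_sums: "(\<lambda>j. G (s j) x) sums G d x" for x
      by (cases "\<exists>k. x \<in> D k") (auto simp: G_in G_out intro!: sums_mult simp del: of_nat_Suc)
    \<comment> \<open>Non-singularity carries the almost everywhere convergence over to the points
      \<open>\<phi> r x\<close>, so \<open>W\<close> may be applied term by term.\<close>
    have "AE x in M. \<forall>r\<in>{1..n}. (\<lambda>k. f k (\<phi> r x)) sums (\<Sum>k. f k (\<phi> r x))"
      using sums by (intro AE_finite_allI nonsingular_AE[OF ns, where P = "\<lambda>x. (\<lambda>k. f k x) sums (\<Sum>k. f k x)"])
        (auto elim: eventually_mono)
    moreover have "AE x in M. \<forall>k. W (f k) x = W (G (s k)) x" unfolding AE_all_countable using eq by blast
    ultimately have "AE x in M. W (\<lambda>x. \<Sum>k. f k x) x = W (G d) x"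
    proof eventually_elim
      case (elim x)
      have "(\<lambda>k. W (f k) x) sums W (\<lambda>x. \<Sum>k. f k x) x"
        using elim(1) by (intro W_sums) auto
      moreover have "(\<lambda>k. W (f k) x) sums W (G d) x"
        unfolding elim(2)[rule_format] by (intro W_sums G_sums)
      ultimately show ?case by (rule sums_unique2)
    qed
    moreover have "(\<lambda>x. \<Sum>k. f k x) \<in> borel_measurable M" by measurable
    ultimately show "Q d (\<Sum>k. c k)"
      using bound by (intro QI[of "\<lambda>x. \<Sum>k. f k x"])
  qed
  then obtain C where C: "\<And>d. norm d \<le> 1 \<Longrightarrow> Q d C" by blast
  have "real (Suc k) \<le> C" for k
  proof (rule ccontr)
    assume k: "\<not> real (Suc k) \<le> C"
    \<comment> \<open>The unit vector of coordinate \<open>k\<close>; on a discrete space every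
      function is continuous.\<close>
    have "(\<lambda>j :: nat discrete. of_bool (j = discrete k) :: complex) \<in> bcontfun"
      by (rule bcontfun_normI[of _ 1]) (auto simp: continuous_on_open_vimage open_discrete)
    then obtain d :: "nat discrete \<Rightarrow>\<^sub>C complex" where d: "\<And>j. d j = of_bool (j = discrete k)"
      by (metis bcontfunE)
    have "norm d \<le> 1" by (rule norm_bound) (auto simp: d)
    then obtain f where f[measurable]: "f \<in> borel_measurable M"
      and le: "AE x in M. cmod (f x) \<le> C" and eq: "AE x in M. W f x = W (G d) x"
      using C by (auto simp: Q_def)
    have "cmod (G d x) \<le> real (Suc k)" for x
      by (cases "\<exists>j. x \<in> D j") (auto simp: G_in G_out d norm_mult discrete_inject simp del: of_nat_Suc)
    then have "ae_class M (G d) \<in> Linf_space M"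
      by (intro Linf_spaceI[of _ _ "real (Suc k)"] AE_I2) simp_all
    moreover have "ae_class M f \<in> Linf_space M"
      using f le by (rule Linf_spaceI)
    moreover have "wco M n u \<phi> (ae_class M f) = wco M n u \<phi> (ae_class M (G d))"
      using eq by (simp add: wco_eq ae_class_eq_iff)
    ultimately have "ae_class M f = ae_class M (G d)" using inj by (auto dest: inj_onD)
    then have "AE x in M. f x = G d x" by (simp add: ae_class_eq_iff)
    \<comment> \<open>On \<open>D k\<close> the function \<open>f\<close> would equal
      \<open>Suc k\<close>, which exceeds its bound \<open>C\<close>; hence \<open>D k\<close> is
      null.\<close>
    with le have "AE x in M. x \<notin> D k"
    proof eventually_elim
      case (elim x)
      then show ?case using k G_in[of x k d] by (auto simp: d simp del: of_nat_Suc)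
    qed
    then have "D k \<in> null_sets M" by (simp add: AE_iff_null_sets)
    then show False using pos[of k] by auto
  qed
  moreover
  obtain k :: nat where "C < real k" using reals_Archimedean2 by blast
  then have "C < real (Suc k)" by simp
  ultimately show False by (meson not_le)
qed

section \<open>Closedness of a finite-dimensional range\<close>

text \<open>By \<open>simple\<close> and \<open>W_eq_0_AE\<close>, every class in the range is a
  combination of the images \<open>v i\<close> of indicators. An L^q limit of such combinations is
  an almost everywhere limit along a subsequence, to which \<open>span_closed_pointwise\<close>
  applies.\<close>

lemma closedin_range_of_finite:
  assumes range: "range_W \<subseteq> Lp_space M q"
    and F: "finite F" and A[measurable]: "\<And>i. i \<in> F \<Longrightarrow> A i \<in> sets M"
    and simple: "\<And>f :: 'a \<Rightarrow> complex. f \<in> borel_measurable M \<Longrightarrow>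
      \<exists>c. AE x in M. J x = 0 \<or> f x = (\<Sum>i\<in>F. c i * indicator (A i) x)"
  shows "closedin (Lp_topology M q) range_W"
proof -
  interpret Lp: Metric_space "Lp_space M q" "Lp_dist M q" by (rule Metric_space_Lp[OF q])
  define v where "v = (\<lambda>i. W (indicator (A i)))"
  have v[measurable]: "v i \<in> borel_measurable M" if "i \<in> F" for i
    using that by (auto simp: v_def)
  have comb: "(\<lambda>x. \<Sum>i\<in>F. a i * v i x) = W (\<lambda>x. \<Sum>i\<in>F. a i * indicator (A i) x)" for a
    by (simp add: W_sum v_def fun_eq_iff)
  show ?thesis unfolding Lp.metric_closedin_iff_sequentially_closed
  proof (intro conjI range allI impI, elim conjE)
    fix \<sigma> l assume \<sigma>: "range \<sigma> \<subseteq> range_W" and lim: "limitin Lp.mtopology \<sigma> l sequentially"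
    have "\<exists>c. \<sigma> k = ae_class M (\<lambda>x. \<Sum>i\<in>F. c i * v i x)" for k
    proof -
      obtain f C where f[measurable]: "f \<in> borel_measurable M" and k: "\<sigma> k = wco M n u \<phi> (ae_class M f)"
        using \<sigma> by (auto elim!: Linf_spaceE simp: image_subset_iff)
      obtain c where c: "AE x in M. J x = 0 \<or> f x = (\<Sum>i\<in>F. c i * indicator (A i) x)"
        using simple[OF f] by blast
      then have "AE x in M. W (\<lambda>x. f x - (\<Sum>i\<in>F. c i * indicator (A i) x)) x = 0"
        by (intro W_eq_0_AE) (auto elim!: eventually_mono)
      then have "\<sigma> k = ae_class M (W (\<lambda>x. \<Sum>i\<in>F. c i * indicator (A i) x))"
        by (simp add: k wco_eq ae_class_eq_iff W_diff)
      then show ?thesis by (auto simp: comb)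
    qed
    then obtain c where c: "\<And>k. \<sigma> k = ae_class M (\<lambda>x. \<Sum>i\<in>F. c k i * v i x)" by metis
    define g where "g = (\<lambda>k x. \<Sum>i\<in>F. c k i * v i x)"
    have \<sigma>_eq: "\<sigma> = (\<lambda>k. ae_class M (g k))" using c by (simp add: g_def fun_eq_iff)
    have [measurable]: "g k \<in> borel_measurable M" for k unfolding g_def by measurable
    have g_Lp: "ae_class M (g k) \<in> Lp_space M q" for k
      using c[of k] range_subsetD[OF \<sigma>, of k] range by (auto simp: g_def)
    obtain y where y[measurable]: "y \<in> borel_measurable M" and l: "l = ae_class M y"
      using Lp.limitin_mspace[OF lim] by (auto simp: Lp_space_def)
    have y_Lp: "ae_class M y \<in> Lp_space M q" using Lp.limitin_mspace[OF lim] by (simp add: l)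
    have "(\<lambda>k. \<integral>x. cmod (g k x - y x) powr q \<partial>M) \<longlonglongrightarrow> 0"
      using lim limitin_Lp_iff[OF q \<open>\<And>k. g k \<in> borel_measurable M\<close> g_Lp y y_Lp]
      unfolding \<sigma>_eq l by (rule iffD1[rotated])
    moreover have "integrable M (\<lambda>x. cmod (g k x - y x) powr q)" for k
      using Minkowski_powr(1)[OF q, of "g k" M "\<lambda>x. - y x"] g_Lp[of k] y_Lp by (simp add: ae_class_in_Lp_space_iff)
    ultimately obtain r where r: "AE x in M. (\<lambda>k. cmod (g (r k) x - y x) powr q) \<longlonglongrightarrow> 0"
      using tendsto_L1_AE_subseq[of M "\<lambda>k x. cmod (g k x - y x) powr q"] by auto
    \<comment> \<open>Collects the points of convergence, so that one choice of coefficients serves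
      almost every point simultaneously.\<close>
    define X where "X = {x. (\<lambda>k. \<Sum>i\<in>F. c (r k) i * v i x) \<longlonglongrightarrow> y x}"
    have X: "AE x in M. x \<in> X" using r
    proof eventually_elim
      case (elim x)
      then have "(\<lambda>k. (cmod (g (r k) x - y x) powr q) powr (1 / q)) \<longlonglongrightarrow> 0 powr (1 / q)"
        using q by (intro tendsto_powr') auto
      then have "(\<lambda>k. g (r k) x) \<longlonglongrightarrow> y x"
        using q by (simp add: powr_powr tendsto_norm_zero_iff LIM_zero_iff)
      then show ?case by (simp add: X_def g_def)
    qed
    obtain a where a: "\<And>x. x \<in> X \<Longrightarrow> y x = (\<Sum>i\<in>F. a i * v i x)"
      using span_closed_pointwise[OF F, of X "\<lambda>k. c (r k)" v y] by (auto simp: X_def)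
    define f where "f = (\<lambda>x. \<Sum>i\<in>F. a i * indicator (A i) x)"
    have [measurable]: "f \<in> borel_measurable M" unfolding f_def by measurable
    have "AE x in M. y x = W f x"
      using X a by (auto simp: f_def W_sum v_def elim!: eventually_mono)
    then have "l = wco M n u \<phi> (ae_class M f)" by (simp add: l wco_eq ae_class_eq_iff)
    moreover have "ae_class M f \<in> Linf_space M"
      by (rule Linf_spaceI[of _ _ "\<Sum>i\<in>F. cmod (a i)"])
         (auto simp: f_def norm_mult indicator_def intro!: AE_I2 sum_norm_le)
    ultimately show "l \<in> range_W" by blast
  qed
qed

end

section \<open>Functions on atoms, and sparse subsequences of a convergent sum\<close>

lemma AE_atom_value:
  assumes "is_atom M A" "emeasure M A < \<infinity>" "f \<in> borel_measurable M"
  shows "AE x in M. x \<in> A \<longrightarrow> f x = atom_value M f A"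
  unfolding atom_value_def using ae_const_on_atom[OF assms] by (rule theI')

lemma set_nn_integral_atom:
  assumes "is_atom M A" "emeasure M A < \<infinity>" "f \<in> borel_measurable M"
  shows "(\<integral>\<^sup>+x\<in>A. f x \<partial>M) = atom_value M f A * emeasure M A"
proof -
  have "(\<integral>\<^sup>+x\<in>A. f x \<partial>M) = (\<integral>\<^sup>+x. atom_value M f A * indicator A x \<partial>M)"
    using AE_atom_value[OF assms] by (intro nn_integral_cong_AE) (auto elim!: eventually_mono simp: indicator_def)
  then show ?thesis using assms(1) by (simp add: nn_integral_cmult_indicator is_atom_def)
qed

text \<open>To reach the \<open>ennreal\<close> case, \<open>exp\<close> maps the real and imaginary
  parts injectively into the positive numbers; \<open>ln\<close> brings the constants back.\<close>

lemma AE_complex_const_on_atom: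
  fixes f :: "'a \<Rightarrow> complex"
  assumes A: "is_atom M A" "emeasure M A < \<infinity>" and [measurable]: "f \<in> borel_measurable M"
  shows "\<exists>c. AE x in M. x \<in> A \<longrightarrow> f x = c"
proof -
  have real: "\<exists>c. AE x in M. x \<in> A \<longrightarrow> g x = c" if [measurable]: "g \<in> borel_measurable M" for g :: "'a \<Rightarrow> real"
  proof -
    have "AE x in M. x \<in> A \<longrightarrow> ennreal (exp (g x)) = atom_value M (\<lambda>x. ennreal (exp (g x))) A"
      by (rule AE_atom_value[OF A]) measurable
    then have "AE x in M. x \<in> A \<longrightarrow> g x = ln (enn2real (atom_value M (\<lambda>x. ennreal (exp (g x))) A))"
      by eventually_elim (metis enn2real_ennreal exp_ge_zero ln_exp)
    then show ?thesis by blast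
  qed
  obtain a b where "AE x in M. x \<in> A \<longrightarrow> Re (f x) = a" "AE x in M. x \<in> A \<longrightarrow> Im (f x) = b"
    using real[of "\<lambda>x. Re (f x)"] real[of "\<lambda>x. Im (f x)"] by auto
  then have "AE x in M. x \<in> A \<longrightarrow> f x = Complex a b"
    by eventually_elim (auto simp: complex_eq_iff)
  then show ?thesis by blast
qed

text \<open>A finite sum has only finitely many terms above a given positive threshold, so far
  enough out there is always a term small enough for the next weight.\<close>

lemma summable_ennreal_sparse_subsequence:
  fixes a :: "nat \<Rightarrow> ennreal" and w :: "nat \<Rightarrow> real"
  assumes "infinite I" "infsum a I < \<infinity>" "\<And>k. 0 < w k"
  obtains e where "strict_mono e" "\<And>k. e k \<in> I" "(\<Sum>k. ennreal (w k) * a (e k)) < \<infinity>"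
proof -
  have ex: "\<exists>i\<in>I. N < i \<and> ennreal (w k) * a i \<le> ennreal ((1/2) ^ k)" for N k
  proof (rule ccontr)
    assume *: "\<not> ?thesis"
    \<comment> \<open>Chosen so that \<open>w k * b = (1/2) ^ k\<close>: otherwise all terms beyond
      \<open>N\<close> would be at least \<open>b\<close>, making the sum infinite.\<close>
    define b where "b = (1/2) ^ k / w k"
    have b: "0 < b" using assms(3) by (simp add: b_def)
    have "ennreal b \<le> a i" if "i \<in> I - {..N}" for i
    proof (rule ccontr)
      assume "\<not> ennreal b \<le> a i"
      then have "ennreal (w k) * a i \<le> ennreal (w k) * ennreal b" by (intro mult_left_mono) auto
      also have "\<dots> = ennreal ((1/2) ^ k)"
        using assms(3)[of k] b by (simp add: b_def flip: ennreal_mult)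
      finally show False using * that by auto
    qed
    then have "infsum a (I - {..N}) = \<infinity>"
      using b assms(1) by (intro infsum_superconst_infinite_ennreal[of _ "ennreal b"]) auto
    moreover have "infsum a (I - {..N}) \<le> infsum a I"
      by (intro infsum_mono_neutral nonneg_summable_on_complete) auto
    ultimately show False using assms(2) by simp
  qed
  have "\<exists>e. \<forall>k. (e k \<in> I \<and> ennreal (w k) * a (e k) \<le> ennreal ((1/2) ^ k)) \<and> e k < e (Suc k)"
    by (rule dependent_nat_choice) (use ex in blast)+
  then obtain e where e: "\<And>k. e k \<in> I" "\<And>k. ennreal (w k) * a (e k) \<le> ennreal ((1/2) ^ k)" "\<And>k. e k < e (Suc k)"
    by blast
  have "(\<Sum>k. ennreal (w k) * a (e k)) \<le> (\<Sum>k. ennreal ((1/2) ^ k))"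
    using e(2) by (intro suminf_le) auto
  also have "\<dots> < \<infinity>"
    by (subst suminf_ennreal2) auto
  finally show ?thesis using e by (intro that[of e]) (auto simp: strict_mono_Suc_iff)
qed

section \<open>Both implications for the atomic decomposition\<close>

theorem theorem2p5:
  fixes M :: "'a measure" and B :: "'a set" and I :: "nat set" and A :: "nat \<Rightarrow> 'a set"
    and q :: real and n :: nat
    and u :: "nat \<Rightarrow> 'a \<Rightarrow> complex" and \<phi> :: "nat \<Rightarrow> 'a \<Rightarrow> 'a"
  assumes "sigma_finite_measure M"
    and "atomic_decomposition M B I A"
    and "1 \<le> q" and "1 \<le> n"
    and "\<And>r. r \<in> {1..n} \<Longrightarrow> u r \<in> borel_measurable M"
    and "\<And>r. r \<in> {1..n} \<Longrightarrow> nonsingular_map M (\<phi> r)"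
    and "\<And>r. r \<in> {1..n} \<Longrightarrow> sigma_finite_subalgebra M (preimage_algebra M (\<phi> r))"
    and "wco M n u \<phi> \<in> Linf_space M \<rightarrow> Lp_space M q"
  defines "J \<equiv> wco_J M q n u \<phi>"
  shows
    "(closedin (Lp_topology M q) (wco M n u \<phi> ` Linf_space M) \<and>
      inj_on (wco M n u \<phi>) (Linf_space M) \<and>
      (\<Sum>\<^sub>\<infinity>i\<in>I. atom_value M J (A i) * emeasure M (A i)) < \<infinity>
        \<longrightarrow> finite {i \<in> I. atom_value M J (A i) > 0})
     \<and>
     ((AE x in M. x \<in> B \<longrightarrow> J x = 0) \<and> finite {i \<in> I. atom_value M J (A i) > 0}
        \<longrightarrow> closedin (Lp_topology M q) (wco M n u \<phi> ` Linf_space M))"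
proof -
  interpret weighted_composition_sum M q n u \<phi>
    by (intro weighted_composition_sum.intro weighted_composition_sum_axioms.intro assms)
  have J_eq: "J = wco_J M q n u \<phi>" by (simp add: J_def)
  have atom: "is_atom M (A i)" "emeasure M (A i) < \<infinity>" "A i \<in> sets M" "0 < emeasure M (A i)" if "i \<in> I" for i
    using assms(2) that by (auto simp: atomic_decomposition_def is_atom_def)
  have disj: "disjoint_family_on A I" and space: "space M = B \<union> (\<Union>i\<in>I. A i)"
    using assms(2) by (auto simp: atomic_decomposition_def)
  have J_const: "AE x in M. x \<in> A i \<longrightarrow> J x = atom_value M J (A i)" if "i \<in> I" for i
    using AE_atom_value[OF atom(1,2)[OF that]] J_measurable by (simp add: J_eq)
  show ?thesis
  proof (intro conjI impI; elim conjE)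
    assume clo: "closedin (Lp_topology M q) range_W" and inj: "inj_on (wco M n u \<phi>) (Linf_space M)"
      and sum: "(\<Sum>\<^sub>\<infinity>i\<in>I. atom_value M J (A i) * emeasure M (A i)) < \<infinity>"
    \<comment> \<open>The argument gives finiteness of the whole index set: infinitely many atoms
      would contain a subsequence on which the weighted series converges, contrary to
      \<open>disjoint_sequence_J_not_summable\<close>.\<close>
    have "finite I"
    proof (rule ccontr)
      assume "infinite I"
      then obtain e where e: "strict_mono e" "\<And>k. e k \<in> I"
        and fin: "(\<Sum>k. ennreal (real (Suc k) powr q) * (atom_value M J (A (e k)) * emeasure M (A (e k)))) < \<infinity>"
        using sum summable_ennreal_sparse_subsequence[of I _ "\<lambda>k. real (Suc k) powr q"] by auto
      have "disjoint_family (\<lambda>k. A (e k))"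
        using disj e strict_mono_eq[OF e(1)] by (auto simp: disjoint_family_on_def)
      then have "(\<Sum>k. ennreal (real (Suc k) powr q) * (\<integral>\<^sup>+x\<in>A (e k). J x \<partial>M)) = \<infinity>"
        unfolding J_eq by (intro disjoint_sequence_J_not_summable clo inj atom e)
      then show False
        using fin J_measurable by (simp add: set_nn_integral_atom[OF atom(1,2)[OF e(2)]] J_eq)
    qed
    then show "finite {i \<in> I. atom_value M J (A i) > 0}" by simp
  next
    assume B: "AE x in M. x \<in> B \<longrightarrow> J x = 0" and fin: "finite {i \<in> I. atom_value M J (A i) > 0}"
    define F where "F = {i \<in> I. atom_value M J (A i) > 0}"
    show "closedin (Lp_topology M q) range_W"
    proof (rule closedin_range_of_finite)
      show "range_W \<subseteq> Lp_space M q" using assms(8) by auto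
      show "finite F" using fin by (simp add: F_def)
      show "A i \<in> sets M" if "i \<in> F" for i using that atom by (simp add: F_def)
      fix f :: "'a \<Rightarrow> complex" assume f: "f \<in> borel_measurable M"
      have "\<forall>i\<in>I. \<exists>c. AE x in M. x \<in> A i \<longrightarrow> f x = c"
        using AE_complex_const_on_atom[OF atom(1,2) f] by blast
      then obtain c where c: "\<And>i. i \<in> I \<Longrightarrow> AE x in M. x \<in> A i \<longrightarrow> f x = c i" by metis
      have "AE x in M. \<forall>i\<in>I. (x \<in> A i \<longrightarrow> f x = c i) \<and> (x \<in> A i \<longrightarrow> J x = atom_value M J (A i))"
        using c J_const by (subst AE_ball_countable) auto
      then have "AE x in M. J x = 0 \<or> f x = (\<Sum>i\<in>F. c i * indicator (A i) x)"
        using B AE_space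
      proof eventually_elim
        case (elim x)
        \<comment> \<open>On \<open>B\<close> and on atoms outside \<open>F\<close> the weight
          \<open>J\<close> vanishes; on an atom in \<open>F\<close>, disjointness leaves only its
          own coefficient in the sum.\<close>
        consider "x \<in> B" | i where "i \<in> I" "x \<in> A i" using elim(3) space by auto
        then show ?case
        proof cases
          case 1
          then show ?thesis using elim by simp
        next
          case 2
          have "indicator (A j) x = (of_bool (j = i) :: complex)" if "j \<in> F" for j
            using 2 disj that by (auto simp: disjoint_family_on_def F_def indicator_def)
          then have "(\<Sum>j\<in>F. c j * indicator (A j) x) = (\<Sum>j\<in>F. if j = i then c j else 0)"
            by (intro sum.cong) auto
          also have "\<dots> = (if i \<in> F then c i else 0)" using fin by (simp add: F_def)
          finally show ?thesis
            using 2 elim(1) by (cases "i \<in> F") (auto simp: F_def)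
        qed
      qed
      then show "\<exists>c. AE x in M. wco_J M q n u \<phi> x = 0 \<or> f x = (\<Sum>i\<in>F. c i * indicator (A i) x)"
        by (auto simp: J_eq)
    qed
  qed
qed

end
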